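(* Let $\mathcal{W}$ be a labeled wedge. Then its associated graph $\Gamma=\Gamma_{\mathcal{W}}$ has bounded cycles, and its spectral determinant $P(t)$ defines a holomorphic function in the unit disk. Moreover, the growth rate $r$ of $\Gamma$ equals the inverse of the smallest real positive root of $P(z)$, in the following sense: $P(z)\neq 0$ for $|z|<r^{-1}$ and, if $r>1$, then $P(r^{-1})=0$.
   Context: Let $\Sigma:=\{(i,j)\in\mathbb{N}^2 : 1\le i<j\}$ (the wedge). A labeled wedge $\mathcal{W}$ is an assignment $\Sigma\to\{N,S\}$ of a label $N$ (non-separated) or $S$ (separated) to each element of $\Sigma$. The associated directed graph $\Gamma_{\mathcal{W}}$ has vertex set $\Sigma$ and the following edges: if $(i,j)$ is non-separated, it has a unique outgoing edge, $(i,j)\to(i+1,j+1)$; if $(i,j)$ is separated, it has exactly two outgoing edges, $(i,j)\to(1,j+1)$ and $(i,j)\to(1,i+1)$. A closed path of length $n\ge1$ in a directed graph is a sequence $(e_1,\dots,e_n)$ of edges such that the target of $e_i$ is the source of $e_{i+1}$ for $1\le i\le n-1$ and the target of $e_n$ is the source of $e_1$; closed paths with different starting vertices are considered different. A simple cycle is a closed path whose edges have pairwise distinct sources, up to cyclic permutation. A multi-cycle $\gamma$ is a union of finitely many simple cycles with pairwise disjoint vertex sets; $C(\gamma)$ is its number of components and $\ell(\gamma)$ the sum of their lengths; the empty multi-cycle ($C=\ell=0$) is included. A graph has bounded cycles if the outgoing degrees of its vertices are uniformly bounded and for each $n\ge1$ there are at most finitely many simple cycles of length $n$; then the number $C(\Gamma,n)$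 of closed paths of length $n$ is finite, the growth rate is $r:=\limsup_n\sqrt[n]{C(\Gamma,n)}$, and the spectral determinant is $P(t):=\sum_{\gamma\text{ multi-cycle}}(-1)^{C(\gamma)}t^{\ell(\gamma)}$. If $r=0$, $r^{-1}$ is understood as $+\infty$. *)

theory Defs
  imports "HOL-Complex_Analysis.Complex_Analysis" "Graph_Theory.Arc_Walk"
begin

context wf_digraph
begin

definition closed_paths :: "nat \<Rightarrow> 'b list set" where
  "closed_paths n = {p. closed_w p \<and> length p = n}"

(* A closed path modulo cyclic permutation is its class under rotation of the edge list. *)
definition simple_cycles :: "'b list set set" where
  "simple_cycles = {p. closed_w p \<and> distinct (map (tail G) p)} // {(p, q). \<exists>k. q = rotate k p}"

definition cycle_length :: "'b list set \<Rightarrow> nat" where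
  "cycle_length c = (THE n. \<exists>p\<in>c. length p = n)"

definition cycle_verts :: "'b list set \<Rightarrow> 'a set" where
  "cycle_verts c = (\<Union>p\<in>c. tail G ` set p)"

(* A multi-cycle is given by its set of components; disjoint simple cycles are recovered
   from their union as its connected components, so nothing is lost. *)
definition multi_cycles :: "'b list set set set" where
  "multi_cycles = {\<gamma>. finite \<gamma> \<and> \<gamma> \<subseteq> simple_cycles \<and>
     pairwise (\<lambda>c d. disjnt (cycle_verts c) (cycle_verts d)) \<gamma>}"

definition multi_cycle_length :: "'b list set set \<Rightarrow> nat" where
  "multi_cycle_length \<gamma> = (\<Sum>c\<in>\<gamma>. cycle_length c)"

definition bounded_cycles :: bool where
  "bounded_cycles \<longleftrightarrow>
     (\<exists>D. \<forall>v\<in>verts G. finite (out_arcs G v) \<and> out_degree G v \<le> D) \<and>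
     (\<forall>n\<ge>1. finite {c \<in> simple_cycles. cycle_length c = n})"

(* The next two definitions are meaningful for graphs with bounded cycles, where
   closed_paths n and the index sets of the sums are finite. *)
definition growth_rate :: ereal where
  "growth_rate = limsup (\<lambda>n. ereal (root n (real (card (closed_paths n)))))"

definition spectral_det :: "complex fps" where
  "spectral_det = Abs_fps (\<lambda>n. \<Sum>\<gamma> | \<gamma> \<in> multi_cycles \<and> multi_cycle_length \<gamma> = n. (-1) ^ card \<gamma>)"

end

datatype wedge_label = Nonseparated | Separated

definition wedge :: "(nat \<times> nat) set" where
  "wedge = {(i, j). 1 \<le> i \<and> i < j}"

(* The two targets (1, j+1) and (1, i+1) are distinct because i < j, so an edge is
   determined by its end points. Labels outside the wedge are irrelevant. *)
definition wedge_graph ::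
    "(nat \<times> nat \<Rightarrow> wedge_label) \<Rightarrow> (nat \<times> nat, (nat \<times> nat) \<times> (nat \<times> nat)) pre_digraph" where
  "wedge_graph W =
     \<lparr>verts = wedge,
      arcs = {((i, j), (i + 1, j + 1)) | i j. (i, j) \<in> wedge \<and> W (i, j) = Nonseparated} \<union>
             {((i, j), (1, j + 1)) | i j. (i, j) \<in> wedge \<and> W (i, j) = Separated} \<union>
             {((i, j), (1, i + 1)) | i j. (i, j) \<in> wedge \<and> W (i, j) = Separated},
      tail = fst, head = snd\<rparr>"

lemma wf_digraph_wedge_graph: "wf_digraph (wedge_graph W)"
  by unfold_locales (auto simp: wedge_graph_def wedge_def)

end

theory Submission
  imports Defs
begin

text \<open>
  The bridge between closed paths and the spectral determinant is the identity of formal power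
  series \<open>P' = - Q * P\<close> with \<open>Q = \<Sum>\<^sub>n C(\<Gamma>, n + 1) t\<^sup>n\<close>; it says that
  \<open>P = exp (- \<Sum>\<^sub>n C(\<Gamma>, n) t\<^sup>n / n)\<close>, as for \<open>det (1 - t A)\<close> of a finite
  matrix. It holds for every digraph with finitely many closed paths of each length. In terms of
  coefficients it is a recursion of Newton type (\<open>spectral_det_newton\<close>), which is proved by a
  sign-reversing involution on pairs of a multi-cycle \<open>\<gamma>\<close> and a closed path \<open>w\<close>. One walks along \<open>w\<close>
  until, for the first time, it either reaches a vertex of \<open>\<gamma>\<close> or comes back to a vertex of its
  own. In the first case the component of \<open>\<gamma>\<close> that was hit is moved from \<open>\<gamma>\<close> into \<open>w\<close>, in the second
  case the simple cycle just closed is moved from \<open>w\<close> to \<open>\<gamma>\<close>. These moves are inverse to each other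
  and change the number of components by one. What they leave over are the simple
  \<open>w\<close> disjoint from \<open>\<gamma>\<close>, that is, multi-cycles with a marked starting arc.

  The radius of convergence of \<open>Q\<close> is \<open>1 / r\<close> by the root test. On the disk of that radius \<open>P\<close> is an
  exponential, hence it has no zero there. The coefficients of \<open>Q\<close> are nonnegative, so the argument
  of Pringsheim applies: if \<open>1 / r\<close> is smaller than the radius of convergence of \<open>P\<close> and
  \<open>P (1 / r) \<noteq> 0\<close>, then \<open>- log \<bar>P\<bar>\<close> is bounded on the real radius, hence on the whole disk,
  \<open>P\<close> has no zero on a slightly larger disk either, and \<open>Q = - P' / P\<close> converges there, which is a
  contradiction (\<open>eval_fps_eq_0_at_log_deriv_radius\<close>).

  For the wedge it remains to see that \<open>P\<close> converges in the unit disk, that is, that the number of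
  multi-cycles of length \<open>n\<close> grows subexponentially. Call the arcs \<open>(i, j) \<rightarrow> (1, i + 1)\<close> back arcs.
  All other arcs increase the second coordinate by one, so that every cycle contains a back arc,
  and a multi-cycle is determined by its back arcs: from a back arc on, one follows the only arc
  that is not a back arc until the next prescribed back arc (\<open>back_tails_inj\<close>). As the heads of the
  arcs of a multi-cycle are distinct, its back arcs have distinct first coordinates \<open>i\<close>. Comparing
  the sums of the first coordinates of heads and tails shows that these \<open>i\<close> add up to at
  most \<open>n\<close>, so there are at most \<open>sqrt (2 n)\<close> of them (\<open>card_back_tails\<close>). Each starts in a box of
  \<open>2 n\<^sup>2\<close> vertices, which leaves about \<open>(2 n\<^sup>2) ^ sqrt (2 n)\<close> multi-cycles.
\<close>

section \<open>Power series with a prescribed logarithmic derivative\<close>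

lemma fps_conv_radius_integral0_ge:
  fixes Q :: "'a :: {banach, real_normed_field} fps"
  shows "fps_conv_radius (fps_integral0 Q) \<ge> fps_conv_radius Q"
  unfolding fps_conv_radius_def
proof (rule conv_radius_geI_ex)
  fix r :: real assume r: "r > 0" "ereal r < conv_radius (fps_nth Q)"
  define z where "z = (of_real r :: 'a)"
  have z: "norm z = r" using r by (simp add: z_def)
  have "summable (\<lambda>n. norm (fps_nth Q n * z ^ n))"
    using r z by (intro abs_summable_in_conv_radius) simp
  hence s: "summable (\<lambda>n. r * norm (fps_nth Q n * z ^ n))" by (rule summable_mult)
  have "summable (\<lambda>n. fps_nth (fps_integral0 Q) (Suc n) * z ^ Suc n)"
  proof (rule summable_comparison_test'[OF s, of 0])
    fix n
    have "norm (fps_nth Q n) / real (Suc n) \<le> norm (fps_nth Q n)"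
      by (simp add: divide_le_eq mult_le_cancel_left1)
    hence "norm (fps_nth Q n) / real (Suc n) * (r * r ^ n) \<le> norm (fps_nth Q n) * (r * r ^ n)"
      using r by (intro mult_right_mono) auto
    thus "norm (fps_nth (fps_integral0 Q) (Suc n) * z ^ Suc n) \<le> r * norm (fps_nth Q n * z ^ n)"
      using r z by (simp add: fps_integral_def norm_mult norm_divide norm_power norm_inverse
          field_simps del: of_nat_Suc)
  qed
  hence "summable (\<lambda>n. fps_nth (fps_integral0 Q) n * z ^ n)"
    by (subst (asm) summable_Suc_iff)
  thus "\<exists>z. norm z = r \<and> summable (\<lambda>n. fps_nth (fps_integral0 Q) n * z ^ n)"
    using z by blast
qed

text \<open>
  Both sides solve the same linear differential equation with the same initial value, and over a
  power series the equation determines the coefficients one after the other. Comparing with the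
  Taylor series of the exponential, rather than with \<open>P\<close> on its disk of convergence, also yields
  that \<open>P\<close> converges wherever \<open>Q\<close> does.
\<close>

lemma
  fixes P Q :: "complex fps"
  assumes ode: "fps_deriv P = - Q * P" and P0: "fps_nth P 0 = 1"
    and pos: "fps_conv_radius Q > 0"
  shows fps_conv_radius_log_deriv: "fps_conv_radius P \<ge> fps_conv_radius Q"
    and eval_fps_log_deriv: "ereal (norm z) < fps_conv_radius Q \<Longrightarrow>
           eval_fps P z = exp (- eval_fps (fps_integral0 Q) z)"
proof -
  define R where "R = fps_conv_radius Q"
  define F where "F = fps_integral0 Q"
  define g where "g = (\<lambda>z. exp (- eval_fps F z))"
  define G where "G = fps_expansion g 0"
  have RF: "fps_conv_radius F \<ge> R" unfolding F_def R_def by (rule fps_conv_radius_integral0_ge)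
  have holo: "g holomorphic_on eball 0 R"
    unfolding g_def using RF by (intro holomorphic_intros) auto
  have R: "R > 0" using pos by (simp add: R_def)
  have gG: "g has_fps_expansion G"
    unfolding G_def using R holo by (intro has_fps_expansion_fps_expansion[of "eball 0 R"]) (auto simp: zero_ereal_def)
  have dg: "deriv g z = - eval_fps Q z * g z" if "ereal (norm z) < R" for z
  proof -
    have "(eval_fps F has_field_derivative eval_fps (fps_deriv F) z) (at z)"
      using less_le_trans[OF that RF] by (intro has_field_derivative_eval_fps) auto
    hence "(g has_field_derivative - eval_fps (fps_deriv F) z * g z) (at z)"
      unfolding g_def using less_le_trans[OF that RF] by (auto intro!: derivative_eq_intros)
    thus ?thesis by (simp add: DERIV_imp_deriv F_def fps_deriv_fps_integral)
  qed
  have "deriv g has_fps_expansion fps_deriv G" using gG by (rule has_fps_expansion_deriv)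
  moreover have "(\<lambda>z. - eval_fps Q z * g z) has_fps_expansion (- Q * G)"
    using gG R by (intro has_fps_expansion_mult has_fps_expansion_minus eval_fps_has_fps_expansion) (auto simp: R_def)
  moreover have "eventually (\<lambda>z. z \<in> eball 0 R) (nhds (0::complex))"
    using R by (intro eventually_nhds_in_open) (auto simp: zero_ereal_def)
  hence "eventually (\<lambda>z. deriv g z = - eval_fps Q z * g z) (nhds 0)"
    by eventually_elim (use dg in auto)
  hence "deriv g has_fps_expansion (- Q * G) \<longleftrightarrow> (\<lambda>z. - eval_fps Q z * g z) has_fps_expansion (- Q * G)"
    by (intro has_fps_expansion_cong refl)
  ultimately have odeG: "fps_deriv G = - Q * G"
    using fps_expansion_unique_complex by blast
  have G0: "fps_nth G 0 = 1"
    unfolding G_def by (simp add: fps_expansion_def g_def F_def eval_fps_at_0)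
  have "fps_nth P n = fps_nth G n" for n
  proof (induction n rule: less_induct)
    case (less n)
    show ?case
    proof (cases n)
      case 0 thus ?thesis using P0 G0 by simp
    next
      case (Suc m)
      have "fps_nth (fps_deriv P) m = fps_nth (fps_deriv G) m"
        unfolding ode odeG fps_mult_nth by (intro sum.cong) (auto simp: less Suc)
      thus ?thesis by (simp add: Suc del: of_nat_Suc)
    qed
  qed
  hence PG: "P = G" by (simp add: fps_eq_iff)
  show "fps_conv_radius P \<ge> fps_conv_radius Q"
    using conv_radius_fps_expansion[OF holo] by (simp add: PG G_def R_def)
  show "eval_fps P z = exp (- eval_fps (fps_integral0 Q) z)" if "ereal (norm z) < fps_conv_radius Q"
    using eval_fps_expansion'[OF holo, of z] that by (simp add: PG G_def R_def g_def F_def)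
qed

lemma eval_fps_norm_le:
  fixes F :: "complex fps"
  assumes nonneg: "\<And>n. fps_nth F n \<in> \<real>\<^sub>\<ge>\<^sub>0"
    and le: "norm z \<le> x" and x: "ereal x < fps_conv_radius F"
  shows "norm (eval_fps F z) \<le> Re (eval_fps F (of_real x))"
proof -
  have x0: "x \<ge> 0" using le norm_ge_zero[of z] by linarith
  have nF: "fps_nth F n = of_real (norm (fps_nth F n))" for n
    using nonneg[of n] by (metis nonneg_Reals_cases norm_of_real abs_of_nonneg)
  have sx: "(\<lambda>n. fps_nth F n * of_real x ^ n) sums eval_fps F (of_real x)"
    using x x0 by (intro sums_eval_fps) simp
  have "(\<lambda>n. Re (fps_nth F n * of_real x ^ n)) sums Re (eval_fps F (of_real x))"
    by (rule sums_Re[OF sx])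
  also have "(\<lambda>n. Re (fps_nth F n * of_real x ^ n)) = (\<lambda>n. norm (fps_nth F n) * x ^ n)"
    by (subst nF) (simp flip: of_real_power)
  finally have sx': "(\<lambda>n. norm (fps_nth F n) * x ^ n) sums Re (eval_fps F (of_real x))" .
  have "norm (\<Sum>n. fps_nth F n * z ^ n) \<le> (\<Sum>n. norm (fps_nth F n) * x ^ n)"
    using sx' le by (intro norm_suminf_le)
      (auto simp: norm_mult norm_power sums_iff intro!: mult_left_mono power_mono)
  thus ?thesis using sx' by (simp add: eval_fps_def sums_iff)
qed

text \<open>
  Pringsheim's argument for the logarithm of \<open>1 / P\<close>. If \<open>P\<close> does not vanish at \<open>\<rho>\<close>, then
  \<open>\<bar>P\<bar>\<close> is bounded below by some \<open>\<delta> > 0\<close> on the real radius close to \<open>\<rho>\<close>. Since the integral of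
  \<open>Q\<close> has nonnegative coefficients, the bound spreads to the open disk, by continuity to the
  closed disk, and so \<open>P\<close> has no zero in a neighbourhood of the closed disk. Then \<open>- P' / P\<close> is
  holomorphic on a disk larger than the disk of convergence of its series \<open>Q\<close>, which is absurd.
\<close>

theorem eval_fps_eq_0_at_log_deriv_radius:
  fixes P Q :: "complex fps"
  assumes ode: "fps_deriv P = - Q * P" and P0: "fps_nth P 0 = 1"
    and nonneg: "\<And>n. fps_nth Q n \<in> \<real>\<^sub>\<ge>\<^sub>0"
    and \<rho>: "fps_conv_radius Q = ereal \<rho>" "\<rho> > 0" "ereal \<rho> < fps_conv_radius P"
  shows "eval_fps P (of_real \<rho>) = 0"
proof (rule ccontr)
  assume nz: "eval_fps P (of_real \<rho>) \<noteq> 0"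
  define F where "F = fps_integral0 Q"
  have RF: "fps_conv_radius F \<ge> ereal \<rho>"
    using fps_conv_radius_integral0_ge[of Q] \<rho> by (simp add: F_def)
  have Fnn: "fps_nth F n \<in> \<real>\<^sub>\<ge>\<^sub>0" for n
  proof (cases n)
    case (Suc m)
    obtain q where "fps_nth Q m = of_real q" "q \<ge> 0" using nonneg[of m] by (rule nonneg_Reals_cases)
    hence "fps_nth F n = of_real (q / real (Suc m))"
      by (simp add: F_def fps_integral_def Suc field_simps)
    thus ?thesis using \<open>q \<ge> 0\<close> by (simp del: of_real_divide)
  qed (simp add: F_def fps_integral_def)
  have ev: "eval_fps P z = exp (- eval_fps F z)" if "norm z < \<rho>" for z
    unfolding F_def using ode P0 by (rule eval_fps_log_deriv) (use \<rho> that in auto)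
  have cont: "continuous_on (cball 0 \<rho>) (eval_fps P)"
    using le_less_trans[OF _ \<rho>(3)] by (intro continuous_on_subset[OF continuous_on_eval_fps]) auto
  define \<delta> where "\<delta> = norm (eval_fps P (of_real \<rho>)) / 2"
  have \<delta>: "\<delta> > 0" using nz by (simp add: \<delta>_def)
  have "((\<lambda>x. norm (eval_fps P (of_real x))) \<longlongrightarrow> norm (eval_fps P (of_real \<rho>))) (at_left \<rho>)"
    using \<rho> by (intro tendsto_norm isCont_tendsto_compose[OF continuous_eval_fps] tendsto_of_real
          tendsto_ident_at) auto
  hence "eventually (\<lambda>x. norm (eval_fps P (of_real x)) > \<delta>) (at_left \<rho>)"
    by (rule order_tendstoD) (use nz in \<open>simp add: \<delta>_def\<close>)
  then obtain y where y: "y < \<rho>" "\<And>x. y < x \<Longrightarrow> x < \<rho> \<Longrightarrow> norm (eval_fps P (of_real x)) > \<delta>"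
    by (subst (asm) eventually_at_left[of 0]) (use \<rho> in auto)
  have low: "norm (eval_fps P z) \<ge> \<delta>" if z: "norm z < \<rho>" for z
  proof -
    obtain x where x: "max y (norm z) < x" "x < \<rho>" using dense[of "max y (norm z)" \<rho>] y z by auto
    have x0: "x \<ge> 0" using x norm_ge_zero[of z] by linarith
    have "Re (eval_fps F z) \<le> norm (eval_fps F z)" by (rule complex_Re_le_cmod)
    also have "\<dots> \<le> Re (eval_fps F (of_real x))"
      using x less_le_trans[OF _ RF, of "ereal x"] by (intro eval_fps_norm_le Fnn) auto
    finally have "exp (- Re (eval_fps F (of_real x))) \<le> exp (- Re (eval_fps F z))" by simp
    also have "exp (- Re (eval_fps F (of_real x))) = norm (eval_fps P (of_real x))"
      using x x0 by (subst ev) auto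
    finally show ?thesis using y(2)[of x] x z by (simp add: ev)
  qed
  have nz_cball: "eval_fps P z \<noteq> 0" if "z \<in> cball 0 \<rho>" for z
  proof -
    have "continuous_on (closure (ball 0 \<rho>)) (\<lambda>z. norm (eval_fps P z))"
      using cont \<rho> by (auto intro: continuous_on_norm)
    moreover have "z \<in> closure (ball 0 \<rho>)" using that \<rho> by auto
    ultimately have "norm (eval_fps P z) \<ge> \<delta>"
      by (rule continuous_ge_on_closure) (use low in auto)
    thus ?thesis using \<delta> by auto
  qed
  define B where "B = eball 0 (fps_conv_radius P) \<inter> eval_fps P -` (-{0})"
  have "open B" unfolding B_def
    by (intro continuous_open_preimage continuous_on_eval_fps open_eball) auto
  moreover have "cball 0 \<rho> \<subseteq> B"
    using nz_cball le_less_trans[OF _ \<rho>(3)] by (auto simp: B_def)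
  ultimately obtain \<epsilon> where \<epsilon>: "\<epsilon> > 0" "(\<Union>x\<in>cball 0 \<rho>. ball x \<epsilon>) \<subseteq> B"
    by (rule compact_subset_open_imp_ball_epsilon_subset[OF compact_cball])
  have big: "z \<in> B" if "norm z < \<rho> + \<epsilon>" for z
  proof (cases "norm z \<le> \<rho>")
    case True
    thus ?thesis using \<epsilon> by force
  next
    case False
    \<comment> \<open>the point of the closed disk nearest to \<open>z\<close>\<close>
    define x where "x = (\<rho> / norm z) *\<^sub>R z"
    have nz: "norm z > 0" using False \<rho> by linarith
    have "z - x = (1 - \<rho> / norm z) *\<^sub>R z" by (simp add: x_def algebra_simps)
    hence "norm (z - x) = \<bar>1 - \<rho> / norm z\<bar> * norm z" by simp
    also have "\<dots> = norm z - \<rho>" using False nz \<rho> by (simp add: abs_if field_simps)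
    finally have "dist x z < \<epsilon>" using that by (simp add: dist_norm norm_minus_commute)
    moreover have "x \<in> cball 0 \<rho>" using nz \<rho> by (simp add: x_def)
    ultimately show ?thesis using \<epsilon>(2) mem_ball by blast
  qed
  have Qeq: "Q = - fps_deriv P / P"
    using P0 by (subst ode) (simp add: fps_divide_unit mult.assoc inverse_mult_eq_1')
  have RP: "ereal (\<rho> + \<epsilon>) \<le> fps_conv_radius P"
  proof (rule ccontr)
    assume "\<not> ?thesis"
    then obtain p where p: "fps_conv_radius P = ereal p" "p < \<rho> + \<epsilon>" "p > \<rho>"
      using \<rho>(3) by (cases "fps_conv_radius P") (auto simp: not_le)
    have "of_real p \<in> B" using p \<rho> by (intro big) auto
    thus False using p \<rho> by (simp add: B_def)
  qed
  have pos: "0 < ereal (\<rho> + \<epsilon>)" using \<rho> \<epsilon> by (simp add: zero_ereal_def)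
  have RP': "ereal (\<rho> + \<epsilon>) \<le> fps_conv_radius (- fps_deriv P)"
    using RP fps_conv_radius_deriv[of P] by (simp add: order_trans)
  have "fps_conv_radius Q \<ge>
      Min {ereal (\<rho> + \<epsilon>), fps_conv_radius (- fps_deriv P), fps_conv_radius P}"
    unfolding Qeq
    by (rule fps_conv_radius_divide')
       (use big pos less_le_trans[OF pos RP] less_le_trans[OF pos RP'] in \<open>auto simp: B_def\<close>)
  hence "ereal (\<rho> + \<epsilon>) \<le> ereal \<rho>" using RP RP' \<rho> by (simp add: min_def split: if_splits)
  thus False using \<epsilon> by simp
qed

section \<open>Simple cycles and multi-cycles\<close>

context wf_digraph
begin

lemma awalk_append_iff_ex: "awalk u (p @ q) v \<longleftrightarrow> (\<exists>w. awalk u p w \<and> awalk w q v)"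
  by (metis awalk_append_iff awalk_appendI)

lemma awalk_start: "awalk u p v \<Longrightarrow> p \<noteq> [] \<Longrightarrow> u = tail G (hd p)"
  by (cases p) (auto simp: awalk_simps)

lemma awalk_heads: "awalk u p v \<Longrightarrow> u # map (head G) p = map (tail G) p @ [v]"
  by (induction p arbitrary: u) (auto simp: awalk_simps)

lemma awalk_if_heads:
  "u \<in> verts G \<Longrightarrow> set p \<subseteq> arcs G \<Longrightarrow> u # map (head G) p = map (tail G) p @ [v] \<Longrightarrow> awalk u p v"
  by (induction p arbitrary: u) (auto simp: awalk_simps)

text \<open>
  Being closed becomes an equation between two lists, which commutes with rotation and shows at
  once that heads and tails of a closed walk are the same up to order.
\<close>

lemma closed_w_heads:
  "closed_w p \<longleftrightarrow> p \<noteq> [] \<and> set p \<subseteq> arcs G \<and> map (head G) p = rotate1 (map (tail G) p)"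
proof (cases p)
  case (Cons e es)
  have "closed_w p \<longleftrightarrow> awalk (tail G e) p (tail G e)"
    by (auto simp: closed_w_def Cons awalk_simps)
  also have "\<dots> \<longleftrightarrow> set p \<subseteq> arcs G \<and> map (head G) p = rotate1 (map (tail G) p)"
  proof
    assume "awalk (tail G e) p (tail G e)"
    thus "set p \<subseteq> arcs G \<and> map (head G) p = rotate1 (map (tail G) p)"
      using awalk_heads[of "tail G e" p "tail G e"] by (auto simp: Cons awalk_def)
  next
    assume "set p \<subseteq> arcs G \<and> map (head G) p = rotate1 (map (tail G) p)"
    thus "awalk (tail G e) p (tail G e)" by (intro awalk_if_heads) (auto simp: Cons)
  qed
  finally show ?thesis by (simp add: Cons)
qed (simp add: closed_w_def)

lemma closed_w_rotate: "closed_w p \<Longrightarrow> closed_w (rotate k p)"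
  unfolding closed_w_heads by (auto simp: rotate1_rotate_swap simp flip: rotate_map)

text \<open>
  Inserting or cutting out a closed walk at one of its visits to the starting vertex: the step that
  both directions of the involution below have in common.
\<close>

lemma closed_w_append:
  assumes "closed_w c" "p \<noteq> []" "tail G (hd c) = tail G (hd p)"
  shows "closed_w (q @ c @ p) \<longleftrightarrow> closed_w (q @ p)"
proof -
  have c: "awalk (tail G (hd p)) c (tail G (hd p))"
    using assms unfolding closed_w_def by (metis awalk_start length_greater_0_conv)
  have "awalk u (q @ c @ p) u \<longleftrightarrow> awalk u (q @ p) u" for u
  proof
    assume "awalk u (q @ c @ p) u"
    then obtain w w' where w: "awalk u q w" "awalk w c w'" "awalk w' p u"
      unfolding awalk_append_iff_ex by blast
    have "w = tail G (hd c)" using w(2) assms by (intro awalk_start) (auto simp: closed_w_def)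
    moreover have "w' = tail G (hd p)" using w(3) assms by (intro awalk_start)
    ultimately show "awalk u (q @ p) u" unfolding awalk_append_iff_ex using w assms by auto
  next
    assume "awalk u (q @ p) u"
    then obtain w where w: "awalk u q w" "awalk w p u"
      unfolding awalk_append_iff_ex by blast
    moreover have "w = tail G (hd p)" using w assms by (intro awalk_start)
    ultimately show "awalk u (q @ c @ p) u" unfolding awalk_append_iff_ex using c by auto
  qed
  thus ?thesis using assms by (simp add: closed_w_def)
qed

definition simple_closed_w :: "'b list \<Rightarrow> bool" where
  "simple_closed_w p \<longleftrightarrow> closed_w p \<and> distinct (map (tail G) p)"

definition rotation_class :: "'b list \<Rightarrow> 'b list set" where
  "rotation_class p = range (\<lambda>k. rotate k p)"

lemma rotation_class_self [simp, intro]: "p \<in> rotation_class p"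
  unfolding rotation_class_def by (metis rangeI rotate0 id_apply)

lemma rotation_class_eqI:
  assumes "q \<in> rotation_class p" shows "rotation_class q = rotation_class p"
proof -
  obtain k where q: "q = rotate k p" using assms by (auto simp: rotation_class_def)
  have "\<exists>j. rotate m p = rotate j (rotate k p)" for m
  proof (cases "p = []")
    case False
    have "m + k * (length p - 1) + k = m + k * length p"
      using False by (cases "length p") auto
    hence "rotate (m + k * (length p - 1)) (rotate k p) = rotate (m + k * length p) p"
      by (simp only: rotate_rotate)
    also have "\<dots> = rotate m p"
      by (subst (1 2) rotate_conv_mod) simp
    finally show ?thesis by metis
  qed simp
  thus ?thesis by (auto simp: rotation_class_def q rotate_rotate)
qed

lemma simple_cycles_iff: "C \<in> simple_cycles \<longleftrightarrow> (\<exists>p. simple_closed_w p \<and> C = rotation_class p)"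
proof -
  have "{(p, q). \<exists>k. q = rotate k p} `` {p} = rotation_class p" for p :: "'b list"
    by (auto simp: rotation_class_def)
  thus ?thesis by (auto simp: simple_cycles_def quotient_def simple_closed_w_def)
qed

lemma simple_closed_w_rotate: "simple_closed_w p \<Longrightarrow> simple_closed_w (rotate k p)"
  by (auto simp: simple_closed_w_def closed_w_rotate simp flip: rotate_map)

lemma simple_cyclesD:
  assumes "C \<in> simple_cycles" "p \<in> C"
  shows "simple_closed_w p" "C = rotation_class p"
  using assms rotation_class_eqI
  by (auto simp: simple_cycles_iff) (auto simp: rotation_class_def simple_closed_w_rotate)

lemma cycle_length_rotation_class [simp]: "cycle_length (rotation_class p) = length p"
  unfolding cycle_length_def rotation_class_def by (rule the_equality) auto

lemma cycle_verts_rotation_class [simp]: "cycle_verts (rotation_class p) = tail G ` set p"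
  by (auto simp: cycle_verts_def rotation_class_def)

text \<open>
  A simple cycle has exactly one representing arc list for each of its vertices. Hence inserting a
  component at a given vertex is a well-defined operation.
\<close>

lemma simple_closed_w_rotate_eq:
  assumes "simple_closed_w p" "q \<in> rotation_class p" "tail G (hd q) = tail G (hd p)"
  shows "q = p"
proof -
  obtain k where q: "q = rotate k p" using assms by (auto simp: rotation_class_def)
  have p: "p \<noteq> []" "distinct (map (tail G) p)"
    using assms by (auto simp: simple_closed_w_def closed_w_def)
  have "tail G (p ! (k mod length p)) = tail G (p ! 0)"
    using assms(3) p hd_conv_nth[of p] by (simp add: q hd_rotate_conv_nth)
  hence "map (tail G) p ! (k mod length p) = map (tail G) p ! 0"
    using p by (simp add: nth_map)
  hence "k mod length p = 0" using p by (subst (asm) nth_eq_iff_index_eq) auto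
  thus ?thesis by (simp add: q rotate_conv_mod[of k])
qed

lemma simple_closed_w_start_at:
  assumes "v \<in> tail G ` set p"
  obtains q where "q \<in> rotation_class p" "tail G (hd q) = v"
proof -
  obtain k where k: "k < length p" "tail G (p ! k) = v" using assms by (auto simp: in_set_conv_nth)
  hence "hd (rotate k p) = p ! k" by (subst hd_rotate_conv_nth) auto
  thus ?thesis using that[of "rotate k p"] k by (auto simp: rotation_class_def)
qed

lemma card_rotation_class:
  assumes "simple_closed_w p" shows "card (rotation_class p) = length p"
proof -
  have p: "p \<noteq> []" "distinct (map (tail G) p)"
    using assms by (auto simp: simple_closed_w_def closed_w_def)
  have "rotation_class p = (\<lambda>k. rotate k p) ` {..<length p}"
  proof
    show "rotation_class p \<subseteq> (\<lambda>k. rotate k p) ` {..<length p}"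
    proof
      fix q assume "q \<in> rotation_class p"
      then obtain k where "q = rotate (k mod length p) p"
        unfolding rotation_class_def by (metis imageE rotate_conv_mod)
      thus "q \<in> (\<lambda>k. rotate k p) ` {..<length p}" using p by auto
    qed
  qed (auto simp: rotation_class_def)
  moreover have "inj_on (\<lambda>k. rotate k p) {..<length p}"
  proof (rule inj_onI)
    fix i j assume ij: "i \<in> {..<length p}" "j \<in> {..<length p}" "rotate i p = rotate j p"
    hence "hd (rotate i p) = hd (rotate j p)" by simp
    hence "p ! i = p ! j" using ij(1,2) p by (simp add: hd_rotate_conv_nth)
    hence "map (tail G) p ! i = map (tail G) p ! j" using ij by simp
    thus "i = j" using p ij by (subst (asm) nth_eq_iff_index_eq) auto
  qed
  ultimately show ?thesis by (simp add: card_image)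
qed

definition multi_cycle_verts :: "'b list set set \<Rightarrow> 'a set" where
  "multi_cycle_verts \<gamma> = (\<Union>C\<in>\<gamma>. cycle_verts C)"

lemma multi_cycles_insert:
  assumes "\<gamma> \<in> multi_cycles" "simple_closed_w c" "tail G ` set c \<inter> multi_cycle_verts \<gamma> = {}"
  shows "insert (rotation_class c) \<gamma> \<in> multi_cycles" "rotation_class c \<notin> \<gamma>"
    "card (insert (rotation_class c) \<gamma>) = Suc (card \<gamma>)"
    "multi_cycle_length (insert (rotation_class c) \<gamma>) = length c + multi_cycle_length \<gamma>"
    "multi_cycle_verts (insert (rotation_class c) \<gamma>) = tail G ` set c \<union> multi_cycle_verts \<gamma>"
proof -
  have fin: "finite \<gamma>" using assms by (simp add: multi_cycles_def)
  have c: "c \<noteq> []" using assms by (auto simp: simple_closed_w_def closed_w_def)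
  show nin: "rotation_class c \<notin> \<gamma>"
    using assms(3) c by (auto simp: multi_cycle_verts_def disjoint_iff) (metis cycle_verts_rotation_class hd_in_set imageI)
  show "insert (rotation_class c) \<gamma> \<in> multi_cycles"
    using assms by (auto simp: multi_cycles_def pairwise_insert disjnt_def multi_cycle_verts_def
      simple_cycles_iff)
  show "card (insert (rotation_class c) \<gamma>) = Suc (card \<gamma>)" using fin nin by simp
  show "multi_cycle_length (insert (rotation_class c) \<gamma>) = length c + multi_cycle_length \<gamma>"
    using fin nin by (simp add: multi_cycle_length_def)
  show "multi_cycle_verts (insert (rotation_class c) \<gamma>) = tail G ` set c \<union> multi_cycle_verts \<gamma>"
    by (simp add: multi_cycle_verts_def)
qed

lemma multi_cycles_remove:
  assumes "\<delta> \<in> multi_cycles" "C \<in> \<delta>" "c \<in> C"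
  shows "simple_closed_w c" "C = rotation_class c" "\<delta> - {C} \<in> multi_cycles"
    "tail G ` set c \<inter> multi_cycle_verts (\<delta> - {C}) = {}"
    "insert (rotation_class c) (\<delta> - {C}) = \<delta>"
proof -
  have "C \<in> simple_cycles" using assms by (auto simp: multi_cycles_def)
  from simple_cyclesD[OF this assms(3)] show 1: "simple_closed_w c" "C = rotation_class c" .
  show "\<delta> - {C} \<in> multi_cycles" using assms by (auto simp: multi_cycles_def pairwise_def)
  have "disjnt (cycle_verts C) (cycle_verts D)" if "D \<in> \<delta> - {C}" for D
    using assms that by (auto simp: multi_cycles_def pairwise_def)
  thus "tail G ` set c \<inter> multi_cycle_verts (\<delta> - {C}) = {}"
    unfolding multi_cycle_verts_def 1(2) by (auto simp: disjnt_def)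
  show "insert (rotation_class c) (\<delta> - {C}) = \<delta>" using assms 1 by auto
qed

lemma multi_cycles_cycle_unique:
  assumes "\<delta> \<in> multi_cycles" "C \<in> \<delta>" "D \<in> \<delta>" "v \<in> cycle_verts C" "v \<in> cycle_verts D"
  shows "C = D"
  using assms by (auto simp: multi_cycles_def pairwise_def disjnt_def)

lemma card_Union_multi_cycle:
  assumes "\<gamma> \<in> multi_cycles"
  shows "finite (\<Union>\<gamma>)" "card (\<Union>\<gamma>) = multi_cycle_length \<gamma>"
proof -
  have C: "finite C \<and> card C = cycle_length C" if "C \<in> \<gamma>" for C
  proof -
    have "C \<in> simple_cycles" using that assms by (auto simp: multi_cycles_def)
    then obtain p where p: "simple_closed_w p" "C = rotation_class p"
      by (auto simp: simple_cycles_iff)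
    hence "card C > 0" by (auto simp: card_rotation_class simple_closed_w_def closed_w_def)
    hence "finite C" by (rule card_ge_0_finite)
    thus ?thesis using p by (simp add: card_rotation_class)
  qed
  have fin: "finite \<gamma>" using assms by (simp add: multi_cycles_def)
  show "finite (\<Union>\<gamma>)" using C fin by auto
  have "C \<inter> D = {}" if "C \<in> \<gamma>" "D \<in> \<gamma>" "C \<noteq> D" for C D
    using that multi_cycles_remove(2)[OF assms] by blast
  hence "card (\<Union>\<gamma>) = (\<Sum>C\<in>\<gamma>. card C)"
    using C fin by (intro card_Union_disjoint) (auto simp: pairwise_def disjnt_def)
  thus "card (\<Union>\<gamma>) = multi_cycle_length \<gamma>"
    using C by (simp add: multi_cycle_length_def)
qed

lemma closed_w_nth_head:
  assumes "closed_w p" "k < length p"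
  shows "head G (p ! k) = tail G (p ! (Suc k mod length p))"
proof -
  have "map (head G) p ! k = rotate1 (map (tail G) p) ! k"
    using assms by (simp add: closed_w_heads)
  moreover have "Suc k mod length p < length p" using assms by (intro mod_less_divisor) auto
  ultimately show ?thesis using assms by (simp add: nth_rotate1)
qed

lemma closed_w_head_image:
  assumes "closed_w p" shows "head G ` set p = tail G ` set p"
  using assms unfolding closed_w_heads by (metis set_map set_rotate1)

text \<open>
  Two simple cycles with a common first arc that never branch stay together arc by arc; neither can
  close up earlier than the other, because the longer one would then repeat a vertex.
\<close>

lemma simple_closed_w_eqI:
  assumes p: "simple_closed_w p" and q: "simple_closed_w q" and hd: "hd p = hd q"
    and agree: "\<And>e e'. e \<in> set p \<Longrightarrow> e' \<in> set q \<Longrightarrow> tail G e = tail G e' \<Longrightarrow> e = e'"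
  shows "p = q"
proof -
  have ne: "p \<noteq> []" "q \<noteq> []" and cl: "closed_w p" "closed_w q"
    using p q by (auto simp: simple_closed_w_def closed_w_def)
  have nth: "p ! k = q ! k" if "k < length p" "k < length q" for k
    using that
  proof (induction k)
    case 0 thus ?case using hd ne by (simp add: hd_conv_nth)
  next
    case (Suc k)
    have "tail G (p ! Suc k) = tail G (q ! Suc k)"
      using closed_w_nth_head[OF cl(1), of k] closed_w_nth_head[OF cl(2), of k] Suc by simp
    thus ?case using Suc by (intro agree) auto
  qed
  have le: "\<not> length x < length y"
    if xy: "simple_closed_w x" "simple_closed_w y"
      "\<And>k. k < length x \<Longrightarrow> k < length y \<Longrightarrow> x ! k = y ! k" for x y
  proof
    assume l: "length x < length y"
    have ne: "x \<noteq> []" and cl: "closed_w x" "closed_w y" and d: "distinct (map (tail G) y)"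
      using xy by (auto simp: simple_closed_w_def closed_w_def)
    obtain m where m: "length x = Suc m" using ne by (cases x) auto
    have "tail G (y ! length x) = head G (y ! m)"
      using closed_w_nth_head[OF cl(2), of m] l m by simp
    also have "\<dots> = head G (x ! m)" using xy(3)[of m] l m by simp
    also have "\<dots> = tail G (x ! 0)" using closed_w_nth_head[OF cl(1), of m] m by simp
    also have "\<dots> = tail G (y ! 0)" using xy(3)[of 0] l m by (metis gr0I length_0_conv less_nat_zero_code ne)
    finally have "map (tail G) y ! length x = map (tail G) y ! 0" using l by (subst (1 2) nth_map) auto
    thus False using d l m by (subst (asm) nth_eq_iff_index_eq) auto
  qed
  have "length p = length q"
    using le[OF p q] le[OF q p] nth by force
  thus ?thesis using nth by (intro nth_equalityI) auto
qed

lemma cycle_length_pos: "C \<in> simple_cycles \<Longrightarrow> cycle_length C > 0"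
  by (auto simp: simple_cycles_iff simple_closed_w_def closed_w_def)

lemma cycle_length_le:
  assumes "\<gamma> \<in> multi_cycles" "C \<in> \<gamma>"
  shows "cycle_length C \<le> multi_cycle_length \<gamma>"
  unfolding multi_cycle_length_def using assms
  by (intro member_le_sum) (auto simp: multi_cycles_def)

lemma finite_simple_cycles_length:
  assumes "finite (closed_paths n)"
  shows "finite {C \<in> simple_cycles. cycle_length C = n}"
proof (rule finite_subset)
  show "{C \<in> simple_cycles. cycle_length C = n} \<subseteq> rotation_class ` closed_paths n"
    by (auto simp: simple_cycles_iff closed_paths_def simple_closed_w_def)
qed (use assms in auto)

lemma finite_multi_cycles_length:
  assumes "\<And>n. finite (closed_paths n)"
  shows "finite {\<gamma> \<in> multi_cycles. multi_cycle_length \<gamma> = n}"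
proof (rule finite_subset)
  show "{\<gamma> \<in> multi_cycles. multi_cycle_length \<gamma> = n} \<subseteq>
      Pow (\<Union>m\<le>n. {C \<in> simple_cycles. cycle_length C = m})"
    using cycle_length_le by (auto simp: multi_cycles_def)
  show "finite (Pow (\<Union>m\<le>n. {C \<in> simple_cycles. cycle_length C = m}))"
    using finite_simple_cycles_length assms by auto
qed

definition multi_cycle_arcs :: "'b list set set \<Rightarrow> 'b set" where
  "multi_cycle_arcs \<gamma> = \<Union> (set ` \<Union> \<gamma>)"

lemma set_rotation_class: "q \<in> rotation_class p \<Longrightarrow> set q = set p"
  by (auto simp: rotation_class_def)

lemma multi_cycle_arcs_inj:
  assumes \<gamma>: "\<gamma> \<in> multi_cycles"
  shows "inj_on (tail G) (multi_cycle_arcs \<gamma>)" "inj_on (head G) (multi_cycle_arcs \<gamma>)"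
proof -
  have "e = e'" if e: "e \<in> multi_cycle_arcs \<gamma>" "e' \<in> multi_cycle_arcs \<gamma>"
    and eq: "tail G e = tail G e' \<or> head G e = head G e'" for e e'
  proof -
    obtain p C q D where pq: "e \<in> set p" "p \<in> C" "C \<in> \<gamma>" "e' \<in> set q" "q \<in> D" "D \<in> \<gamma>"
      using e by (auto simp: multi_cycle_arcs_def)
    note p = multi_cycles_remove(1,2)[OF \<gamma> pq(3,2)] and q = multi_cycles_remove(1,2)[OF \<gamma> pq(6,5)]
    have clp: "closed_w p" "distinct (map (tail G) p)" using p by (auto simp: simple_closed_w_def)
    have clq: "closed_w q" using q by (auto simp: simple_closed_w_def)
    have "tail G e \<in> cycle_verts C" "tail G e' \<in> cycle_verts D"
      "head G e \<in> cycle_verts C" "head G e' \<in> cycle_verts D"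
      using pq closed_w_head_image[OF clp(1)] closed_w_head_image[OF clq] by (auto simp: p q)
    hence "C = D" using multi_cycles_cycle_unique[OF \<gamma> pq(3,6)] eq by metis
    hence e': "e' \<in> set p" using pq(4,5) p(2) set_rotation_class by blast
    have "distinct (map (head G) p)" using clp by (simp add: closed_w_heads)
    thus "e = e'" using eq clp(2) pq(1) e' by (auto simp: distinct_map dest: inj_onD)
  qed
  thus "inj_on (tail G) (multi_cycle_arcs \<gamma>)" "inj_on (head G) (multi_cycle_arcs \<gamma>)"
    by (auto intro!: inj_onI)
qed

lemma multi_cycle_arcs_head_image:
  assumes "\<gamma> \<in> multi_cycles"
  shows "head G ` multi_cycle_arcs \<gamma> = tail G ` multi_cycle_arcs \<gamma>"
proof -
  have "head G ` set p = tail G ` set p" if "p \<in> \<Union>\<gamma>" for p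
    using that multi_cycles_remove(1)[OF assms]
    by (intro closed_w_head_image) (auto simp: simple_closed_w_def)
  hence "(\<Union>p\<in>\<Union>\<gamma>. head G ` set p) = (\<Union>p\<in>\<Union>\<gamma>. tail G ` set p)" by (rule SUP_cong[OF refl])
  moreover have "h ` multi_cycle_arcs \<gamma> = (\<Union>p\<in>\<Union>\<gamma>. h ` set p)" for h :: "'b \<Rightarrow> 'a"
    by (auto simp: multi_cycle_arcs_def)
  ultimately show ?thesis by simp
qed

text \<open>
  The heads of the arcs of a multi-cycle are its vertices, each once, and so are the tails. So the
  total change of a vertex weight along the arcs is zero.
\<close>

lemma sum_multi_cycle_arcs_head:
  assumes "\<gamma> \<in> multi_cycles"
  shows "(\<Sum>e\<in>multi_cycle_arcs \<gamma>. f (head G e)) = (\<Sum>e\<in>multi_cycle_arcs \<gamma>. f (tail G e))"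
  using sum.reindex[OF multi_cycle_arcs_inj(1)[OF assms], of f]
    sum.reindex[OF multi_cycle_arcs_inj(2)[OF assms], of f] multi_cycle_arcs_head_image[OF assms]
  by (simp add: o_def)

lemma card_multi_cycle_arcs:
  assumes \<gamma>: "\<gamma> \<in> multi_cycles"
  shows "finite (multi_cycle_arcs \<gamma>)" "card (multi_cycle_arcs \<gamma>) = multi_cycle_length \<gamma>"
proof -
  have fin: "finite \<gamma>" using \<gamma> by (simp add: multi_cycles_def)
  have C: "finite (\<Union>(set ` C)) \<and> card (\<Union>(set ` C)) = cycle_length C \<and>
      tail G ` \<Union>(set ` C) = cycle_verts C" if "C \<in> \<gamma>" for C
  proof -
    have "C \<in> simple_cycles" using that \<gamma> by (auto simp: multi_cycles_def)
    then obtain p where p: "simple_closed_w p" "C = rotation_class p"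
      by (auto simp: simple_cycles_iff)
    have "\<Union>(set ` C) = set p" using set_rotation_class by (auto simp: p)
    moreover have "distinct p" using p(1) by (auto simp: simple_closed_w_def distinct_map)
    ultimately show ?thesis by (simp add: p distinct_card)
  qed
  have eq: "multi_cycle_arcs \<gamma> = (\<Union>C\<in>\<gamma>. \<Union>(set ` C))" by (auto simp: multi_cycle_arcs_def)
  show "finite (multi_cycle_arcs \<gamma>)" unfolding eq using fin C by blast
  have "\<Union>(set ` C) \<inter> \<Union>(set ` D) = {}" if "C \<in> \<gamma>" "D \<in> \<gamma>" "C \<noteq> D" for C D
  proof -
    have "cycle_verts C \<inter> cycle_verts D = {}"
      using that \<gamma> by (auto simp: multi_cycles_def pairwise_def disjnt_def)
    thus ?thesis using C[OF that(1)] C[OF that(2)] by blast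
  qed
  hence "card (multi_cycle_arcs \<gamma>) = (\<Sum>C\<in>\<gamma>. card (\<Union>(set ` C)))"
    unfolding eq using fin C by (intro card_UN_disjoint) auto
  thus "card (multi_cycle_arcs \<gamma>) = multi_cycle_length \<gamma>"
    using C by (simp add: multi_cycle_length_def)
qed

lemma multi_cycle_arcs_subset: "\<gamma> \<in> multi_cycles \<Longrightarrow> multi_cycle_arcs \<gamma> \<subseteq> arcs G"
  using multi_cycles_remove(1) by (force simp: multi_cycle_arcs_def simple_closed_w_def closed_w_heads)

end

section \<open>The spectral determinant and the number of closed paths\<close>

context wf_digraph
begin

text \<open>
  The scanning of a walk has not met any event on the prefix \<open>x\<close>: no vertex of \<open>\<gamma>\<close> has been reached
  and no vertex has been reached twice. Only the tails count, so the final vertex of \<open>x\<close> is still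
  unchecked.
\<close>

definition free_walk :: "'b list set set \<Rightarrow> 'b list \<Rightarrow> bool" where
  "free_walk \<gamma> x \<longleftrightarrow> distinct (map (tail G) x) \<and> tail G ` set x \<inter> multi_cycle_verts \<gamma> = {}"

lemma free_walk_append: "free_walk \<gamma> (x @ y) \<Longrightarrow> free_walk \<gamma> x"
  by (auto simp: free_walk_def)

text \<open>
  The place of the first event is unique. This is what makes the two moves of the involution
  inverse to each other.
\<close>

lemma free_walk_stop_unique:
  assumes "x @ y = x' @ y'" "y \<noteq> []" "y' \<noteq> []" "free_walk \<gamma> x" "free_walk \<gamma> x'"
    "\<not> free_walk \<gamma> (x @ [hd y])" "\<not> free_walk \<gamma> (x' @ [hd y'])"
  shows "x = x' \<and> y = y'"
proof -
  have *: "z = []" if "y = z @ y'" "x' = x @ z" "\<not> free_walk \<gamma> (x @ [hd y])" "free_walk \<gamma> x'"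
    for x x' y y' z
  proof (rule ccontr)
    assume "z \<noteq> []"
    then obtain e zs where "z = e # zs" by (cases z) auto
    thus False using that free_walk_append[of \<gamma> "x @ [e]" zs] by simp
  qed
  from assms(1) obtain z where "x = x' @ z \<and> z @ y = y' \<or> x @ z = x' \<and> y = z @ y'"
    unfolding append_eq_append_conv2 by blast
  thus ?thesis
  proof
    assume z: "x = x' @ z \<and> z @ y = y'"
    hence "z = []" using assms by (intro *[of y' z y x x']) auto
    thus ?thesis using z by simp
  next
    assume z: "x @ z = x' \<and> y = z @ y'"
    hence "z = []" using assms by (intro *[of y z y' x' x]) auto
    thus ?thesis using z by simp
  qed
qed

definition walk_pairs where
  "walk_pairs n = {(\<gamma>, w). \<gamma> \<in> multi_cycles \<and> closed_w w \<and> multi_cycle_length \<gamma> + length w = n}"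

definition hit_pairs where
  "hit_pairs n = {(\<gamma>, a @ b) | \<gamma> a b. (\<gamma>, a @ b) \<in> walk_pairs n \<and> b \<noteq> [] \<and>
     free_walk \<gamma> a \<and> tail G (hd b) \<in> multi_cycle_verts \<gamma>}"

definition loop_pairs where
  "loop_pairs n = {(\<gamma>, a @ c @ b) | \<gamma> a b c. (\<gamma>, a @ c @ b) \<in> walk_pairs n \<and> b \<noteq> [] \<and> closed_w c \<and>
     free_walk \<gamma> (a @ c)}"

definition free_pairs where
  "free_pairs n = {(\<gamma>, w) \<in> walk_pairs n. free_walk \<gamma> w}"

text \<open>
  Both kinds of pairs are parametrised by the same set of data: a multi-cycle \<open>\<gamma>\<close>, a closed walk
  \<open>a @ b\<close>, and a simple cycle \<open>c\<close> through the vertex between \<open>a\<close> and \<open>b\<close>. The cycle can be put into the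
  walk, which gives a pair whose first event is the loop \<open>c\<close>, or into the multi-cycle, which gives a
  pair whose first event is a hit of \<open>c\<close>.
\<close>

definition exchanges where
  "exchanges n = {(\<gamma>, a, c, b). \<gamma> \<in> multi_cycles \<and> closed_w c \<and> closed_w (a @ b) \<and> b \<noteq> [] \<and>
     tail G (hd c) = tail G (hd b) \<and> free_walk \<gamma> (a @ c) \<and>
     multi_cycle_length \<gamma> + length (a @ c @ b) = n}"

lemma loop_returns:
  assumes "closed_w (a @ c @ b)" "closed_w c" "b \<noteq> []"
  shows "tail G (hd c) = tail G (hd b)"
proof -
  obtain u w w' where w: "awalk u a w" "awalk w c w'" "awalk w' b u"
    using assms unfolding closed_w_def awalk_append_iff_ex by blast
  obtain v where v: "awalk v c v" "c \<noteq> []" using assms by (auto simp: closed_w_def)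
  have "w = v" "w' = v" using awalk_ends[OF w(2) v(1)] v(2) by auto
  thus ?thesis using awalk_start[OF w(2) v(2)] awalk_start[OF w(3)] assms by simp
qed

text \<open>
  The first event in the scan of \<open>w\<close>, if there is one, happens at the end of the longest free
  prefix \<open>d\<close>. If the next vertex does not belong to \<open>\<gamma>\<close>, it has been visited before, and the part of \<open>d\<close>
  since that visit is the loop.
\<close>

lemma walk_pairs_trichotomy:
  "walk_pairs n = hit_pairs n \<union> loop_pairs n \<union> free_pairs n"
proof
  show "hit_pairs n \<union> loop_pairs n \<union> free_pairs n \<subseteq> walk_pairs n"
    by (auto simp: hit_pairs_def loop_pairs_def free_pairs_def)
  show "walk_pairs n \<subseteq> hit_pairs n \<union> loop_pairs n \<union> free_pairs n"
  proof
    fix x assume x: "x \<in> walk_pairs n"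
    then obtain \<gamma> w where xw: "x = (\<gamma>, w)" "closed_w w" by (auto simp: walk_pairs_def)
    show "x \<in> hit_pairs n \<union> loop_pairs n \<union> free_pairs n"
    proof (cases "free_walk \<gamma> w")
      case True thus ?thesis using x by (auto simp: free_pairs_def xw)
    next
      case False
      define i where "i = (LEAST i. \<not> free_walk \<gamma> (take i w))"
      have i: "\<not> free_walk \<gamma> (take i w)" unfolding i_def
        by (rule LeastI[of _ "length w"]) (use False in simp)
      have "free_walk \<gamma> (take 0 w)" by (simp add: free_walk_def)
      with i have "i \<noteq> 0" by metis
      then obtain j where j: "i = Suc j" by (cases i) auto
      have fj: "free_walk \<gamma> (take j w)"
        using not_less_Least[of j "\<lambda>i. \<not> free_walk \<gamma> (take i w)"] j by (auto simp: i_def)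
      have jl: "j < length w"
      proof (rule ccontr)
        assume "\<not> j < length w" thus False using i fj by (simp add: j)
      qed
      define d b where "d = take j w" and "b = drop j w"
      have b: "b \<noteq> []" "w = d @ b" using jl by (auto simp: d_def b_def)
      have "take i w = d @ [hd b]" using jl by (simp add: j d_def b_def take_Suc_conv_app_nth hd_drop_conv_nth)
      hence nf: "\<not> free_walk \<gamma> (d @ [hd b])" using i by simp
      have fd: "free_walk \<gamma> d" using fj by (simp add: d_def)
      show ?thesis
      proof (cases "tail G (hd b) \<in> multi_cycle_verts \<gamma>")
        case True
        thus ?thesis using x b fd by (auto simp: hit_pairs_def xw)
      next
        case False
        hence "tail G (hd b) \<in> tail G ` set d" using nf fd by (auto simp: free_walk_def)
        then obtain e where e: "e \<in> set d" "tail G e = tail G (hd b)" by auto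
        then obtain a c' where d: "d = a @ e # c'" by (auto simp: in_set_conv_decomp)
        obtain u v where "awalk u a v" "awalk v (e # c') (tail G (hd b))"
          using \<open>closed_w w\<close> awalk_start[OF _ b(1)] unfolding b(2) d closed_w_def awalk_append_iff_ex
          by (metis)
        hence "closed_w (e # c')" using e unfolding closed_w_def by (auto simp: awalk_simps)
        moreover have "(\<gamma>, a @ (e # c') @ b) \<in> walk_pairs n" "free_walk \<gamma> (a @ e # c')"
          using x fd by (simp_all add: xw b(2) d)
        ultimately have "(\<gamma>, a @ (e # c') @ b) \<in> loop_pairs n"
          unfolding loop_pairs_def using b(1) by blast
        thus ?thesis using xw b d by simp
      qed
    qed
  qed
qed

lemma hit_stop: "tail G (hd b) \<in> multi_cycle_verts \<gamma> \<Longrightarrow> \<not> free_walk \<gamma> (a @ [hd b])"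
  by (auto simp: free_walk_def)

lemma loop_stop: "closed_w c \<Longrightarrow> tail G (hd c) = tail G (hd b) \<Longrightarrow> \<not> free_walk \<gamma> ((a @ c) @ [hd b])"
  by (cases c) (auto simp: free_walk_def closed_w_def)

lemma hit_loop_disjoint: "hit_pairs n \<inter> loop_pairs n = {}"
proof -
  have False if 1: "free_walk \<gamma> a" "b \<noteq> []" "tail G (hd b) \<in> multi_cycle_verts \<gamma>"
    and 2: "a @ b = a' @ c' @ b'" "b' \<noteq> []" "closed_w c'" "free_walk \<gamma> (a' @ c')" "closed_w (a @ b)"
    for \<gamma> a b a' b' c'
  proof -
    have t: "tail G (hd c') = tail G (hd b')" using 2 by (intro loop_returns[of a']) auto
    have "a = a' @ c' \<and> b = b'"
      using 1 2 hit_stop[OF 1(3)] loop_stop[OF 2(3) t]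
      by (intro free_walk_stop_unique[of a b "a' @ c'" b' \<gamma>]) auto
    moreover have "c' \<noteq> []" using 2 by (auto simp: closed_w_def)
    hence "tail G (hd c') \<notin> multi_cycle_verts \<gamma>"
      using 2(4) by (cases c') (auto simp: free_walk_def)
    ultimately show False using t 1 by simp
  qed
  note contra = this
  show ?thesis
  proof (rule equals0I)
    fix x assume x: "x \<in> hit_pairs n \<inter> loop_pairs n"
    from x obtain \<gamma> a b where 1: "x = (\<gamma>, a @ b)" "x \<in> walk_pairs n" "b \<noteq> []" "free_walk \<gamma> a"
      "tail G (hd b) \<in> multi_cycle_verts \<gamma>" by (auto simp: hit_pairs_def)
    from x obtain a' c' b' where 2: "x = (\<gamma>, a' @ c' @ b')" "b' \<noteq> []" "closed_w c'"
      "free_walk \<gamma> (a' @ c')" using 1(1) by (auto simp: loop_pairs_def)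
    show False using contra[OF 1(4,3,5) _ 2(2-4)] 1(1,2) 2(1) by (auto simp: walk_pairs_def)
  qed
qed

lemma free_disjoint: "(hit_pairs n \<union> loop_pairs n) \<inter> free_pairs n = {}"
proof -
  have stop: "\<not> free_walk \<gamma> (a @ b)" if "b \<noteq> []" "\<not> free_walk \<gamma> (a @ [hd b])" for \<gamma> a b
    using that free_walk_append[of \<gamma> "a @ [hd b]" "tl b"] by auto
  have "\<not> free_walk \<gamma> w" if "(\<gamma>, w) \<in> hit_pairs n" for \<gamma> w
    using that hit_stop stop by (auto simp: hit_pairs_def)
  moreover have "\<not> free_walk \<gamma> w" if "(\<gamma>, w) \<in> loop_pairs n" for \<gamma> w
  proof -
    from that obtain a c b where w: "w = (a @ c) @ b" "b \<noteq> []" "closed_w c" "closed_w (a @ c @ b)"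
      by (auto simp: loop_pairs_def walk_pairs_def)
    have "\<not> free_walk \<gamma> ((a @ c) @ [hd b])"
      using w by (intro loop_stop loop_returns)
    thus ?thesis using stop w by blast
  qed
  ultimately show ?thesis by (auto simp: free_pairs_def)
qed

text \<open>
  Given the pair, the end of \<open>a @ c\<close> is known as the place of the first event, and the start of \<open>c\<close> is
  the only earlier visit to the same vertex.
\<close>

lemma bij_exchanges_loop:
  "bij_betw (\<lambda>(\<gamma>, a, c, b). (\<gamma>, a @ c @ b)) (exchanges n) (loop_pairs n)"
proof (rule bij_betw_imageI)
  show "inj_on (\<lambda>(\<gamma>, a, c, b). (\<gamma>, a @ c @ b)) (exchanges n)"
  proof (rule inj_onI)
    fix x x' assume x: "x \<in> exchanges n" "x' \<in> exchanges n"
      "(\<lambda>(\<gamma>, a, c, b). (\<gamma>, a @ c @ b)) x = (\<lambda>(\<gamma>, a, c, b). (\<gamma>, a @ c @ b)) x'"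
    obtain \<gamma> a c b a' c' b' where xx: "x = (\<gamma>, a, c, b)" "x' = (\<gamma>, a', c', b')"
      using x(3) by (cases x; cases x') auto
    have 1: "(\<gamma>, a, c, b) \<in> exchanges n" and 2: "(\<gamma>, a', c', b') \<in> exchanges n"
      and eq: "a @ c @ b = a' @ c' @ b'" using x by (auto simp: xx)
    have "a @ c = a' @ c' \<and> b = b'"
      using 1 2 eq loop_stop by (intro free_walk_stop_unique[of _ _ _ _ \<gamma>]) (auto simp: exchanges_def)
    hence ac: "a @ c = a' @ c'" and b: "b = b'" by auto
    have *: "z = []" if "a' = a @ z" "c = z @ c'" "tail G (hd c) = tail G (hd c')" "c' \<noteq> []"
      "free_walk \<gamma> (a' @ c')" for a a' c c' z
      using that by (cases z; cases c') (auto simp: free_walk_def)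
    have c: "c \<noteq> []" "c' \<noteq> []" "tail G (hd c) = tail G (hd c')"
      using 1 2 b by (auto simp: exchanges_def closed_w_def)
    have f: "free_walk \<gamma> (a @ c)" "free_walk \<gamma> (a' @ c')" using 1 2 by (auto simp: exchanges_def)
    from ac obtain z where "a = a' @ z \<and> z @ c = c' \<or> a @ z = a' \<and> c = z @ c'"
      unfolding append_eq_append_conv2 by blast
    thus "x = x'"
    proof
      assume z: "a = a' @ z \<and> z @ c = c'"
      hence "z = []" using c f by (intro *[of a a' z c' c]) auto
      thus ?thesis using z b by (simp add: xx)
    next
      assume z: "a @ z = a' \<and> c = z @ c'"
      hence "z = []" using c f by (intro *[of a' a z c c']) auto
      thus ?thesis using z b by (simp add: xx)
    qed
  qed
  have "(\<gamma>, a @ c @ b) \<in> loop_pairs n" if "(\<gamma>, a, c, b) \<in> exchanges n" for \<gamma> a c b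
    using that by (auto simp: exchanges_def loop_pairs_def walk_pairs_def closed_w_append intro!: exI)
  moreover have exchange: "(\<gamma>, a, c, b) \<in> exchanges n"
    if "(\<gamma>, a @ c @ b) \<in> walk_pairs n" "b \<noteq> []" "closed_w c" "free_walk \<gamma> (a @ c)" for \<gamma> a c b
    using that loop_returns[of a c b] closed_w_append[of c b a]
    by (auto simp: exchanges_def walk_pairs_def)
  ultimately show "(\<lambda>(\<gamma>, a, c, b). (\<gamma>, a @ c @ b)) ` exchanges n = loop_pairs n"
  proof (intro equalityI subsetI)
    fix y assume "y \<in> loop_pairs n"
    then obtain \<gamma> a b c where y: "y = (\<gamma>, a @ c @ b)" "(\<gamma>, a @ c @ b) \<in> walk_pairs n" "b \<noteq> []"
      "closed_w c" "free_walk \<gamma> (a @ c)" unfolding loop_pairs_def by blast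
    show "y \<in> (\<lambda>(\<gamma>, a, c, b). (\<gamma>, a @ c @ b)) ` exchanges n"
      by (rule rev_image_eqI[OF exchange[OF y(2-5)]]) (simp add: y(1))
  qed auto
qed


lemma exchangesD:
  assumes "(\<gamma>, a, c, b) \<in> exchanges n"
  shows "\<gamma> \<in> multi_cycles" "simple_closed_w c" "tail G ` set c \<inter> multi_cycle_verts \<gamma> = {}"
    "free_walk (insert (rotation_class c) \<gamma>) a" "tail G (hd b) \<in> tail G ` set c"
    "tail G (hd c) = tail G (hd b)" "b \<noteq> []"
proof -
  have c: "c \<noteq> []" using assms by (auto simp: exchanges_def closed_w_def)
  show 1: "\<gamma> \<in> multi_cycles" "simple_closed_w c" "tail G ` set c \<inter> multi_cycle_verts \<gamma> = {}"
    using assms by (auto simp: exchanges_def simple_closed_w_def free_walk_def)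
  show "free_walk (insert (rotation_class c) \<gamma>) a"
    using assms multi_cycles_insert(5)[OF 1] by (auto simp: exchanges_def free_walk_def)
  show "tail G (hd c) = tail G (hd b)" "b \<noteq> []" using assms by (auto simp: exchanges_def)
  thus "tail G (hd b) \<in> tail G ` set c" using c by (metis hd_in_set imageI)
qed

text \<open>
  Given the pair, the end of \<open>a\<close> is known as the place of the first event; the component through the
  vertex that was hit, listed from that vertex on, is \<open>c\<close>.
\<close>

lemma bij_exchanges_hit:
  "bij_betw (\<lambda>(\<gamma>, a, c, b). (insert (rotation_class c) \<gamma>, a @ b)) (exchanges n) (hit_pairs n)"
proof (rule bij_betw_imageI)
  let ?f = "\<lambda>(\<gamma>, a, c, b). (insert (rotation_class c) \<gamma>, a @ b)"
  show "inj_on ?f (exchanges n)"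
  proof (rule inj_onI)
    fix x x' assume x: "x \<in> exchanges n" "x' \<in> exchanges n" "?f x = ?f x'"
    obtain \<gamma> a c b where xx: "x = (\<gamma>, a, c, b)" by (cases x) auto
    obtain \<gamma>' a' c' b' where xx': "x' = (\<gamma>', a', c', b')" by (cases x') auto
    note D = exchangesD[OF x(1)[unfolded xx]] and D' = exchangesD[OF x(2)[unfolded xx']]
    define \<delta> where "\<delta> = insert (rotation_class c) \<gamma>"
    have \<delta>': "\<delta> = insert (rotation_class c') \<gamma>'" and ab: "a @ b = a' @ b'"
      using x(3) by (auto simp: \<delta>_def xx xx')
    have \<delta>: "\<delta> \<in> multi_cycles" unfolding \<delta>_def using D by (intro multi_cycles_insert)
    have v: "tail G (hd b) \<in> multi_cycle_verts \<delta>" "tail G (hd b') \<in> multi_cycle_verts \<delta>"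
      using D(5) multi_cycles_insert(5)[OF D(1-3)] D'(5) multi_cycles_insert(5)[OF D'(1-3)]
      unfolding \<delta>_def[symmetric] \<delta>'[symmetric] by auto
    have in\<delta>: "rotation_class c \<in> \<delta>" "rotation_class c' \<in> \<delta>"
      by (simp add: \<delta>_def) (simp add: \<delta>')
    have "a = a' \<and> b = b'"
      using ab D(7) D'(7) D(4)[folded \<delta>_def] D'(4)[folded \<delta>'] hit_stop[OF v(1)] hit_stop[OF v(2)]
      by (rule free_walk_stop_unique)
    moreover from this have "rotation_class c = rotation_class c'"
      using D(5) D'(5) by (intro multi_cycles_cycle_unique[OF \<delta> in\<delta>, of "tail G (hd b)"]) auto
    moreover from this have "c = c'"
      using D(6) D'(2,6) calculation by (intro simple_closed_w_rotate_eq[of c']) auto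
    moreover have "\<gamma> = \<gamma>'"
      using \<delta>' multi_cycles_insert(2)[OF D(1-3)] multi_cycles_insert(2)[OF D'(1-3)] calculation
      unfolding \<delta>_def by (metis insert_ident)
    ultimately show "x = x'" by (simp add: xx xx')
  qed
  show "?f ` exchanges n = hit_pairs n"
  proof
    show "?f ` exchanges n \<subseteq> hit_pairs n"
    proof
      fix y assume "y \<in> ?f ` exchanges n"
      then obtain \<gamma> a c b where x: "(\<gamma>, a, c, b) \<in> exchanges n"
        and y: "y = (insert (rotation_class c) \<gamma>, a @ b)" by auto
      note D = exchangesD[OF x]
      have "y \<in> walk_pairs n"
        using x multi_cycles_insert(1,4)[OF D(1-3)]
        by (auto simp: y walk_pairs_def exchanges_def)
      thus "y \<in> hit_pairs n" using D(4,5,7) multi_cycles_insert(5)[OF D(1-3)]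
        unfolding y hit_pairs_def by blast
    qed
    show "hit_pairs n \<subseteq> ?f ` exchanges n"
    proof
      fix y assume "y \<in> hit_pairs n"
      then obtain \<delta> a b where y: "y = (\<delta>, a @ b)" "(\<delta>, a @ b) \<in> walk_pairs n" "b \<noteq> []"
        "free_walk \<delta> a" "tail G (hd b) \<in> multi_cycle_verts \<delta>" by (auto simp: hit_pairs_def)
      have \<delta>: "\<delta> \<in> multi_cycles" using y by (auto simp: walk_pairs_def)
      obtain C where C: "C \<in> \<delta>" "tail G (hd b) \<in> cycle_verts C"
        using y(5) by (auto simp: multi_cycle_verts_def)
      then obtain p where p: "p \<in> C" "tail G (hd b) \<in> tail G ` set p"
        by (auto simp: cycle_verts_def)
      obtain c where c: "c \<in> C" "tail G (hd c) = tail G (hd b)"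
        using simple_closed_w_start_at[OF p(2)] multi_cycles_remove(2)[OF \<delta> C(1) p(1)] by metis
      note R = multi_cycles_remove[OF \<delta> C(1) c(1)]
      note I = multi_cycles_insert[OF R(3,1,4)]
      have "free_walk (\<delta> - {C}) (a @ c)"
        using y(4) I(5) R(1,4) unfolding R(5) free_walk_def simple_closed_w_def by auto
      hence "(\<delta> - {C}, a, c, b) \<in> exchanges n"
        using y(2,3) c(2) R(1,3) I(4) unfolding R(5)
        by (auto simp: exchanges_def walk_pairs_def simple_closed_w_def)
      moreover have "y = ?f (\<delta> - {C}, a, c, b)" using R(5) by (simp add: y)
      ultimately show "y \<in> ?f ` exchanges n" by (rule rev_image_eqI)
    qed
  qed
qed

text \<open>
  A multi-cycle of length \<open>n\<close> has \<open>n\<close> such representatives \<open>p\<close>, one for each of its vertices. This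
  is where the factor \<open>n\<close> in the recursion, and thus the derivative of the determinant, comes from.
\<close>

definition rooted_multi_cycles where
  "rooted_multi_cycles n = {(\<gamma>, p). \<gamma> \<in> multi_cycles \<and> multi_cycle_length \<gamma> = n \<and> p \<in> \<Union>\<gamma>}"

lemma free_pairsD:
  assumes "(\<gamma>, w) \<in> free_pairs n"
  shows "\<gamma> \<in> multi_cycles" "simple_closed_w w" "tail G ` set w \<inter> multi_cycle_verts \<gamma> = {}"
  using assms by (auto simp: free_pairs_def walk_pairs_def free_walk_def simple_closed_w_def)

lemma bij_free_rooted:
  "bij_betw (\<lambda>(\<gamma>, w). (insert (rotation_class w) \<gamma>, w)) (free_pairs n) (rooted_multi_cycles n)"
proof (rule bij_betw_imageI)
  let ?f = "\<lambda>(\<gamma>, w). (insert (rotation_class w) \<gamma>, w)"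
  show "inj_on ?f (free_pairs n)"
  proof (rule inj_onI)
    fix x x' assume x: "x \<in> free_pairs n" "x' \<in> free_pairs n" "?f x = ?f x'"
    obtain \<gamma> w \<gamma>' where xx: "x = (\<gamma>, w)" "x' = (\<gamma>', w)"
      and eq: "insert (rotation_class w) \<gamma> = insert (rotation_class w) \<gamma>'"
      using x(3) by (cases x; cases x') auto
    have "rotation_class w \<notin> \<gamma>" "rotation_class w \<notin> \<gamma>'"
      using x(1,2) by (simp_all add: xx multi_cycles_insert(2)[OF free_pairsD])
    thus "x = x'" using eq by (simp add: xx insert_ident)
  qed
  show "?f ` free_pairs n = rooted_multi_cycles n"
  proof
    show "?f ` free_pairs n \<subseteq> rooted_multi_cycles n"
    proof
      fix y assume "y \<in> ?f ` free_pairs n"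
      then obtain \<gamma> w where x: "(\<gamma>, w) \<in> free_pairs n"
        and y: "y = (insert (rotation_class w) \<gamma>, w)" by auto
      show "y \<in> rooted_multi_cycles n"
        using x multi_cycles_insert(1,4)[OF free_pairsD[OF x]]
        by (auto simp: y rooted_multi_cycles_def free_pairs_def walk_pairs_def)
    qed
    show "rooted_multi_cycles n \<subseteq> ?f ` free_pairs n"
    proof
      fix y assume "y \<in> rooted_multi_cycles n"
      then obtain \<delta> w C where y: "y = (\<delta>, w)" "\<delta> \<in> multi_cycles" "multi_cycle_length \<delta> = n"
        "C \<in> \<delta>" "w \<in> C" by (auto simp: rooted_multi_cycles_def)
      note R = multi_cycles_remove[OF y(2,4,5)]
      have "multi_cycle_length \<delta> = length w + multi_cycle_length (\<delta> - {C})"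
        using multi_cycles_insert(4)[OF R(3,1,4)] unfolding R(5) .
      hence "(\<delta> - {C}, w) \<in> free_pairs n"
        using R(1,3,4) y(3)
        by (auto simp: free_pairs_def walk_pairs_def free_walk_def simple_closed_w_def)
      moreover have "y = ?f (\<delta> - {C}, w)" using R(5) by (simp add: y)
      ultimately show "y \<in> ?f ` free_pairs n" by (rule rev_image_eqI)
    qed
  qed
qed

lemma walk_pairs_eq:
  "walk_pairs n = (\<Union>k\<in>{..n}. {\<gamma> \<in> multi_cycles. multi_cycle_length \<gamma> = n - k} \<times> closed_paths k)"
  by (auto simp: walk_pairs_def closed_paths_def)

text \<open>
  The right-hand side is a signed count of pairs of a multi-cycle and a closed path of total length
  \<open>n\<close>. Pairs with a hit cancel against pairs with a loop, and the free pairs are the rooted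
  multi-cycles with one component taken away, which accounts for the sign.
\<close>

theorem spectral_det_newton:
  assumes fin: "\<And>n. finite (closed_paths n)"
  shows "of_nat n * fps_nth spectral_det n =
           - (\<Sum>k\<le>n. fps_nth spectral_det (n - k) * of_nat (card (closed_paths k)))"
proof -
  let ?M = "\<lambda>n. {\<gamma> \<in> multi_cycles. multi_cycle_length \<gamma> = n}"
  let ?s = "\<lambda>(\<gamma>, w :: 'b list). (-1 :: complex) ^ card (\<gamma> :: 'b list set set)"
  have finM: "finite (?M n)" for n using finite_multi_cycles_length fin by blast
  have fin_pairs: "finite (walk_pairs n)"
    unfolding walk_pairs_eq using finM fin by auto
  have hit: "sum ?s (hit_pairs n) = - sum ?s (loop_pairs n)"
  proof -
    have "sum ?s (hit_pairs n) = (\<Sum>(\<gamma>, a, c, b)\<in>exchanges n. (-1) ^ card (insert (rotation_class c) \<gamma>))"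
      by (subst sum.reindex_bij_betw[OF bij_exchanges_hit, symmetric]) (simp add: case_prod_unfold)
    also have "\<dots> = (\<Sum>(\<gamma>, a, c, b)\<in>exchanges n. - ((-1) ^ card \<gamma>))"
    proof (intro sum.cong refl, clarify)
      fix \<gamma> a c b assume "(\<gamma>, a, c, b) \<in> exchanges n"
      from multi_cycles_insert(3)[OF exchangesD(1-3)[OF this]]
      show "(-1) ^ card (insert (rotation_class c) \<gamma>) = - ((-1 :: complex) ^ card \<gamma>)" by simp
    qed
    also have "\<dots> = - sum ?s (loop_pairs n)"
      by (subst sum.reindex_bij_betw[OF bij_exchanges_loop, symmetric])
         (simp add: case_prod_unfold sum_negf)
    finally show ?thesis .
  qed
  have "(\<Sum>k\<le>n. fps_nth spectral_det (n - k) * of_nat (card (closed_paths k))) =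
          (\<Sum>k\<le>n. sum ?s (?M (n - k) \<times> closed_paths k))"
    by (simp add: spectral_det_def sum.cartesian_product[symmetric] sum_distrib_left mult.commute)
  also have "\<dots> = sum ?s (walk_pairs n)"
    unfolding walk_pairs_eq using finM fin
    by (intro sum.UNION_disjoint[symmetric]) (auto simp: closed_paths_def)
  also have "\<dots> = sum ?s (hit_pairs n \<union> loop_pairs n) + sum ?s (free_pairs n)"
    using fin_pairs free_disjoint unfolding walk_pairs_trichotomy by (intro sum.union_disjoint) auto
  also have "sum ?s (hit_pairs n \<union> loop_pairs n) = sum ?s (hit_pairs n) + sum ?s (loop_pairs n)"
    using fin_pairs hit_loop_disjoint unfolding walk_pairs_trichotomy by (intro sum.union_disjoint) auto
  also have "\<dots> = 0" by (simp add: hit)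
  also have "sum ?s (free_pairs n) = (\<Sum>(\<gamma>, w)\<in>free_pairs n. - ((-1) ^ card (insert (rotation_class w) \<gamma>)))"
  proof (intro sum.cong refl, clarify)
    fix \<gamma> w assume "(\<gamma>, w) \<in> free_pairs n"
    from multi_cycles_insert(3)[OF free_pairsD[OF this]]
    show "(-1) ^ card \<gamma> = - ((-1 :: complex) ^ card (insert (rotation_class w) \<gamma>))" by simp
  qed
  also have "\<dots> = - sum ?s (rooted_multi_cycles n)"
    by (subst sum.reindex_bij_betw[OF bij_free_rooted, symmetric])
       (simp add: case_prod_unfold sum_negf)
  also have "rooted_multi_cycles n = (SIGMA \<gamma>:?M n. \<Union>\<gamma>)"
    by (auto simp: rooted_multi_cycles_def)
  also have "sum ?s \<dots> = (\<Sum>\<gamma>\<in>?M n. \<Sum>p\<in>\<Union>\<gamma>. (-1) ^ card \<gamma>)"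
    using finM card_Union_multi_cycle(1) by (subst sum.Sigma) auto
  also have "\<dots> = (\<Sum>\<gamma>\<in>?M n. of_nat n * (-1) ^ card \<gamma>)"
    by (intro sum.cong refl) (auto simp: card_Union_multi_cycle(2))
  also have "\<dots> = of_nat n * fps_nth spectral_det n"
    by (simp add: spectral_det_def sum_distrib_left)
  finally show ?thesis by simp
qed

lemma multi_cycle_length_eq_0_iff:
  assumes "\<gamma> \<in> multi_cycles" shows "multi_cycle_length \<gamma> = 0 \<longleftrightarrow> \<gamma> = {}"
proof
  assume 0: "multi_cycle_length \<gamma> = 0"
  show "\<gamma> = {}"
  proof (rule equals0I)
    fix C assume C: "C \<in> \<gamma>"
    hence "C \<in> simple_cycles" using assms by (auto simp: multi_cycles_def)
    thus False using cycle_length_le[OF assms C] cycle_length_pos[of C] 0 by simp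
  qed
qed (simp add: multi_cycle_length_def)

lemma spectral_det_nth_0 [simp]: "fps_nth spectral_det 0 = 1"
proof -
  have "{} \<in> multi_cycles" by (simp add: multi_cycles_def)
  hence "{\<gamma> \<in> multi_cycles. multi_cycle_length \<gamma> = 0} = {{}}"
    using multi_cycle_length_eq_0_iff by auto
  thus ?thesis by (simp add: spectral_det_def)
qed

definition closed_path_fps :: "complex fps" where
  "closed_path_fps = Abs_fps (\<lambda>n. of_nat (card (closed_paths (Suc n))))"

lemma closed_paths_0 [simp]: "closed_paths 0 = {}"
  by (auto simp: closed_paths_def closed_w_def)

corollary fps_deriv_spectral_det:
  assumes fin: "\<And>n. finite (closed_paths n)"
  shows "fps_deriv spectral_det = - closed_path_fps * spectral_det"
proof (rule fps_ext)
  fix n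
  have "fps_nth (fps_deriv spectral_det) n = of_nat (Suc n) * fps_nth spectral_det (Suc n)" by simp
  also have "\<dots> = - (\<Sum>k\<le>n. fps_nth closed_path_fps k * fps_nth spectral_det (n - k))"
    by (subst spectral_det_newton[OF fin], subst sum.atMost_Suc_shift)
       (simp add: closed_path_fps_def mult.commute)
  also have "\<dots> = fps_nth (- closed_path_fps * spectral_det) n"
    by (simp add: fps_mult_nth atLeast0AtMost sum_negf)
  finally show "fps_nth (fps_deriv spectral_det) n = \<dots>" .
qed

text \<open>
  The Cauchy--Hadamard formula, applied to a shifted sequence.
\<close>

lemma fps_conv_radius_closed_path_fps: "fps_conv_radius closed_path_fps = inverse growth_rate"
proof -
  have "fps_conv_radius closed_path_fps = conv_radius (\<lambda>n. of_nat (card (closed_paths n)) :: complex)"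
    using conv_radius_shift[of "\<lambda>n. of_nat (card (closed_paths n)) :: complex" 1]
    by (simp add: fps_conv_radius_def closed_path_fps_def)
  thus ?thesis by (simp add: conv_radius_def growth_rate_def)
qed

end

section \<open>Two counting lemmas\<close>

text \<open>
  Distinct positive numbers sum up to at least \<open>1 + 2 + \<dots> + card A\<close>.
\<close>

lemma card_mult_Suc_card_le_sum:
  fixes A :: "nat set"
  assumes "finite A" "0 \<notin> A"
  shows "card A * (card A + 1) \<le> 2 * \<Sum>A"
  using assms
proof (induction A rule: finite_linorder_max_induct)
  case (insert b A)
  have "A \<subseteq> {1..<b}" using insert by (force simp: Suc_le_eq intro: gr0I)
  hence "card A \<le> card {1..<b}" by (intro card_mono) auto
  hence "card A + 1 \<le> b" using insert.prems by (cases b) auto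
  moreover have "b \<notin> A" using insert by auto
  ultimately show ?case using insert by (simp add: algebra_simps)
qed simp

lemma card_small_subsets_le:
  assumes "finite X" "X \<noteq> {}"
  shows "card {S. S \<subseteq> X \<and> card S \<le> c} \<le> (c + 1) * card X ^ c"
proof -
  have fin: "finite {xs. set xs \<subseteq> X \<and> length xs \<le> c}"
    using assms by (intro finite_lists_length_le)
  have "{S. S \<subseteq> X \<and> card S \<le> c} \<subseteq> set ` {xs. set xs \<subseteq> X \<and> length xs \<le> c}"
  proof safe
    fix S assume S: "S \<subseteq> X" "card S \<le> c"
    then obtain xs where "set xs = S" "distinct xs"
      using assms finite_distinct_list finite_subset by metis
    thus "S \<in> set ` {xs. set xs \<subseteq> X \<and> length xs \<le> c}"
      using S by (intro image_eqI[of _ _ xs]) (auto simp: distinct_card[symmetric])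
  qed
  hence "card {S. S \<subseteq> X \<and> card S \<le> c} \<le> card {xs. set xs \<subseteq> X \<and> length xs \<le> c}"
    using fin by (rule surj_card_le[rotated])
  also have "\<dots> = (\<Sum>i\<le>c. card X ^ i)" using assms by (intro card_lists_length_le)
  also have "\<dots> \<le> (\<Sum>i\<le>c. card X ^ c)"
    using assms by (intro sum_mono power_increasing) (auto simp: Suc_le_eq card_gt_0_iff)
  finally show ?thesis by simp
qed

section \<open>Closed paths and multi-cycles in the wedge\<close>

locale labeled_wedge =
  fixes W :: "nat \<times> nat \<Rightarrow> wedge_label"

sublocale labeled_wedge \<subseteq> wf_digraph "wedge_graph W"
  by (rule wf_digraph_wedge_graph)

context labeled_wedge
begin

abbreviation "\<Gamma> \<equiv> wedge_graph W"

lemma tail_wedge [simp]: "tail \<Gamma> = fst" and head_wedge [simp]: "head \<Gamma> = snd"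
  by (simp_all add: wedge_graph_def)

definition back_arcs :: "((nat \<times> nat) \<times> (nat \<times> nat)) set" where
  "back_arcs = {((i, j), (1, i + 1)) | i j. (i, j) \<in> wedge \<and> W (i, j) = Separated}"

lemma arc_wedge_iff:
  "((i, j), v) \<in> arcs \<Gamma> \<longleftrightarrow> (i, j) \<in> wedge \<and>
     (case W (i, j) of Nonseparated \<Rightarrow> v = (i + 1, j + 1) | Separated \<Rightarrow> v = (1, j + 1) \<or> v = (1, i + 1))"
  by (auto simp: wedge_graph_def split: wedge_label.splits)

lemma back_arc_iff: "((i, j), v) \<in> back_arcs \<longleftrightarrow> (i, j) \<in> wedge \<and> W (i, j) = Separated \<and> v = (1, i + 1)"
  by (auto simp: back_arcs_def)

lemma arc_fst_le: "e \<in> arcs \<Gamma> \<Longrightarrow> fst (snd e) \<le> fst (fst e) + 1"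
  by (cases e; cases "fst e") (auto simp: arc_wedge_iff split: wedge_label.splits)

lemma arc_snd_if_not_back: "e \<in> arcs \<Gamma> \<Longrightarrow> e \<notin> back_arcs \<Longrightarrow> snd (snd e) = snd (fst e) + 1"
  by (cases e; cases "fst e") (auto simp: arc_wedge_iff back_arc_iff split: wedge_label.splits)

text \<open>
  Without back arcs the second coordinate would increase all along a closed walk.
\<close>

lemma closed_w_has_back_arc:
  assumes "closed_w p" shows "\<exists>e\<in>set p. e \<in> back_arcs"
proof (rule ccontr)
  assume no: "\<not> ?thesis"
  have p: "p \<noteq> []" "set p \<subseteq> arcs \<Gamma>" "map snd p = rotate1 (map fst p)"
    using assms by (simp_all add: closed_w_heads)
  have "sum_list (map (\<lambda>e. snd (snd e)) p) = sum_list (map snd (rotate1 (map fst p)))"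
    by (simp flip: p(3) add: o_def)
  also have "\<dots> = sum_list (map (\<lambda>e. snd (fst e)) p)"
    by (cases p) (simp_all add: o_def)
  also have "map (\<lambda>e. snd (snd e)) p = map (\<lambda>e. snd (fst e) + 1) p"
    using no p(2) arc_snd_if_not_back by (intro map_cong) auto
  finally show False using p(1) by (simp only: sum_list_addf sum_list_triv) simp
qed

text \<open>
  Start the walk of length \<open>n\<close> with a back arc. It leads to the first coordinate \<open>1\<close>, and each
  arc adds at most one, so all first coordinates are at most \<open>n\<close>. Therefore back arcs lead to a
  second coordinate of at most \<open>n + 1\<close>, and the other arcs add one.
\<close>

lemma closed_w_bounds:
  assumes p: "closed_w p" and e: "e \<in> set p"
  shows "fst (fst e) \<in> {1..length p}" "snd (fst e) \<in> {1..2 * length p}"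
proof -
  let ?n = "length p"
  obtain b where b: "b \<in> set p" "b \<in> back_arcs" using closed_w_has_back_arc[OF p] by blast
  then obtain m where m: "m < ?n" "p ! m = b" by (auto simp: in_set_conv_nth)
  define q where "q = rotate m p"
  have q: "closed_w q" "length q = ?n" "set q = set p" "q \<noteq> []"
    using closed_w_rotate[OF p, of m] m by (auto simp: q_def)
  have q0: "q ! 0 = b" using m nth_rotate[of 0 p m] by (cases "p = []") (auto simp: q_def)
  have arcs: "set q \<subseteq> arcs \<Gamma>" using q(1) by (simp add: closed_w_heads)
  have step: "fst (q ! Suc k) = snd (q ! k)" if "Suc k < ?n" for k
    using closed_w_nth_head[OF q(1), of k] that q(2) by simp
  have f: "fst (snd (q ! k)) \<le> k + 1" if "k < ?n" for k
    using that
  proof (induction k)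
    case 0 thus ?case using b(2) by (auto simp: q0 back_arcs_def)
  next
    case (Suc k)
    have "fst (snd (q ! Suc k)) \<le> fst (fst (q ! Suc k)) + 1"
      using Suc.prems q(2) arcs by (intro arc_fst_le subsetD[OF arcs]) auto
    thus ?case using Suc step[of k] by simp
  qed
  have tails: "\<exists>k<?n. fst x = snd (q ! k)" if "x \<in> set q" for x
  proof -
    have "fst x \<in> snd ` set q" using closed_w_head_image[OF q(1)] that by simp
    then obtain y where "y \<in> set q" "fst x = snd y" by auto
    thus ?thesis using q(2) by (metis in_set_conv_nth)
  qed
  have fle: "fst (fst x) \<le> ?n" if "x \<in> set q" for x
    using tails[OF that] f by force
  have s: "snd (snd (q ! k)) \<le> ?n + 1 + k" if "k < ?n" for k
    using that
  proof (induction k)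
    case 0
    have "snd (snd b) = fst (fst b) + 1" using b(2) by (auto simp: back_arcs_def)
    thus ?case using fle[of b] b(1) q(3) by (simp add: q0)
  next
    case (Suc k)
    have x: "q ! Suc k \<in> set q" using Suc.prems q(2) by simp
    show ?case
    proof (cases "q ! Suc k \<in> back_arcs")
      case True
      hence "snd (snd (q ! Suc k)) = fst (fst (q ! Suc k)) + 1" by (auto simp: back_arcs_def)
      thus ?thesis using fle[OF x] by simp
    next
      case False
      thus ?thesis using arc_snd_if_not_back[of "q ! Suc k"] x arcs Suc step[of k] by auto
    qed
  qed
  have e': "e \<in> set q" using e q(3) by simp
  hence "e \<in> arcs \<Gamma>" using arcs by blast
  hence "fst e \<in> wedge" by (cases e; cases "fst e") (auto simp: arc_wedge_iff)
  hence pos: "fst (fst e) \<ge> 1" "snd (fst e) \<ge> 1" by (auto simp: wedge_def)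
  obtain k where "k < ?n" "fst e = snd (q ! k)" using tails[OF e'] by blast
  thus "fst (fst e) \<in> {1..length p}" "snd (fst e) \<in> {1..2 * length p}"
    using fle[OF e'] s[of k] pos by auto
qed

lemma finite_closed_paths: "finite (closed_paths n)"
proof (rule finite_subset)
  let ?V = "{1..n} \<times> {1..2 * n}"
  show "closed_paths n \<subseteq> {p. set p \<subseteq> ?V \<times> ?V \<and> length p = n}"
  proof safe
    fix p i j k l assume p: "p \<in> closed_paths n"
    thus "length p = n" by (simp add: closed_paths_def)
    have cl: "closed_w p" using p by (simp add: closed_paths_def)
    have V: "fst ` set p \<subseteq> ?V"
      using closed_w_bounds[OF cl] \<open>length p = n\<close> by (force simp: mem_Times_iff)
    hence "snd ` set p \<subseteq> ?V" using closed_w_head_image[OF cl] by simp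
    with V show "i \<in> {1..n}" "j \<in> {1..2 * n}" "k \<in> {1..n}" "l \<in> {1..2 * n}"
      if "((i, j), (k, l)) \<in> set p" using that by force+
  qed
  show "finite {p. set p \<subseteq> ?V \<times> ?V \<and> length p = n}"
    by (intro finite_lists_length_eq) auto
qed

lemma bounded_cycles_wedge: "bounded_cycles"
  unfolding bounded_cycles_def
proof (intro conjI exI ballI allI impI)
  fix v :: "nat \<times> nat"
  obtain i j where v: "v = (i, j)" by (cases v)
  have sub: "out_arcs \<Gamma> v \<subseteq> {(v, (i + 1, j + 1)), (v, (1, j + 1)), (v, (1, i + 1))}"
    by (auto simp: out_arcs_def v arc_wedge_iff split: wedge_label.splits)
  show "finite (out_arcs \<Gamma> v)" by (rule finite_subset[OF sub]) simp
  have "out_degree \<Gamma> v \<le> card {(v, (i + 1, j + 1)), (v, (1, j + 1)), (v, (1, i + 1))}"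
    unfolding out_degree_def by (rule card_mono[OF _ sub]) simp
  also have "\<dots> \<le> 3" by (simp add: card_insert_if)
  finally show "out_degree \<Gamma> v \<le> 3" .
next
  fix n show "finite {c \<in> simple_cycles. cycle_length c = n}"
    by (intro finite_simple_cycles_length finite_closed_paths)
qed

text \<open>
  The head of a back arc depends on its tail, so this set of vertices encodes the set of back arcs.
\<close>

definition back_tails where
  "back_tails \<gamma> = fst ` (multi_cycle_arcs \<gamma> \<inter> back_arcs)"

lemma back_tails_iff:
  "(i, j) \<in> back_tails \<gamma> \<longleftrightarrow> ((i, j), (1, i + 1)) \<in> multi_cycle_arcs \<gamma> \<inter> back_arcs"
  by (force simp: back_tails_def back_arc_iff)

text \<open>
  At a common vertex two multi-cycles could branch only if one of them left it by its back arc and the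
  other did not.
\<close>

lemma multi_cycle_arcs_agree:
  assumes \<gamma>: "\<gamma> \<in> multi_cycles" "\<delta> \<in> multi_cycles" and eq: "back_tails \<gamma> = back_tails \<delta>"
    and e: "e \<in> multi_cycle_arcs \<gamma>" "e' \<in> multi_cycle_arcs \<delta>" "fst e = fst e'"
  shows "e = e'"
proof -
  have *: "e = e'" if "\<gamma> \<in> multi_cycles" "\<delta> \<in> multi_cycles" "back_tails \<gamma> = back_tails \<delta>"
    "e \<in> multi_cycle_arcs \<gamma>" "e' \<in> multi_cycle_arcs \<delta>" "fst e = fst e'" and b: "e \<in> back_arcs" for \<gamma> \<delta> e e'
  proof -
    obtain i j where ij: "e = ((i, j), (1, i + 1))" using b by (auto simp: back_arcs_def)
    have "e \<in> multi_cycle_arcs \<delta>"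
      using that b back_tails_iff[of i j \<gamma>] back_tails_iff[of i j \<delta>] by (simp add: ij)
    thus ?thesis using multi_cycle_arcs_inj(1)[OF that(2)] that by (auto dest: inj_onD)
  qed
  obtain i j v v' where ij: "e = ((i, j), v)" "e' = ((i, j), v')" using e(3) by (cases e; cases e') auto
  have arcs: "((i, j), v) \<in> arcs \<Gamma>" "((i, j), v') \<in> arcs \<Gamma>"
    using multi_cycle_arcs_subset \<gamma> e ij by blast+
  show ?thesis
  proof (cases "e \<in> back_arcs \<or> e' \<in> back_arcs")
    case True
    thus ?thesis using *[OF \<gamma> eq e] *[OF \<gamma>(2,1) eq[symmetric] e(2,1) e(3)[symmetric]] by auto
  next
    case False
    thus ?thesis using arcs by (auto simp: ij arc_wedge_iff back_arc_iff split: wedge_label.splits)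
  qed
qed

text \<open>
  Every component contains a back arc, which by assumption belongs to a component of the other
  multi-cycle as well. As the two components cannot branch, they coincide.
\<close>

lemma back_tails_inj: "inj_on back_tails multi_cycles"
proof (rule inj_onI)
  have "\<gamma> \<subseteq> \<delta>" if \<gamma>: "\<gamma> \<in> multi_cycles" "\<delta> \<in> multi_cycles" and eq: "back_tails \<gamma> = back_tails \<delta>" for \<gamma> \<delta>
  proof
    fix C assume C: "C \<in> \<gamma>"
    hence "C \<in> simple_cycles" using \<gamma>(1) by (auto simp: multi_cycles_def)
    then obtain p0 where p0: "simple_closed_w p0" "C = rotation_class p0"
      by (auto simp: simple_cycles_iff)
    obtain b where b: "b \<in> set p0" "b \<in> back_arcs"
      using closed_w_has_back_arc[of p0] p0(1) unfolding simple_closed_w_def by blast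
    have "fst b \<in> back_tails \<gamma>" using b C p0 unfolding back_tails_def multi_cycle_arcs_def by blast
    hence "b \<in> multi_cycle_arcs \<delta>"
      using eq b(2) by (cases b; cases "fst b") (auto simp: back_tails_iff back_arc_iff)
    then obtain D q0 where D: "D \<in> \<delta>" "q0 \<in> D" "b \<in> set q0" by (auto simp: multi_cycle_arcs_def)
    have D': "D = rotation_class q0" using multi_cycles_remove[OF \<gamma>(2) D(1,2)] by blast
    obtain p where p: "p \<in> rotation_class p0" "fst (hd p) = fst b"
      using simple_closed_w_start_at[of "fst b" p0] b by auto
    obtain q where q: "q \<in> rotation_class q0" "fst (hd q) = fst b"
      using simple_closed_w_start_at[of "fst b" q0] D by auto
    have pC: "p \<in> C" "q \<in> D" using p q p0 D' by auto
    have sp: "simple_closed_w p" and Cp: "C = rotation_class p"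
      using multi_cycles_remove(1,2)[OF \<gamma>(1) C pC(1)] by auto
    have sq: "simple_closed_w q" and Dq: "D = rotation_class q"
      using multi_cycles_remove(1,2)[OF \<gamma>(2) D(1) pC(2)] by auto
    have ag: "x = y" if "x \<in> set p" "y \<in> set q" "tail \<Gamma> x = tail \<Gamma> y" for x y
    proof (rule multi_cycle_arcs_agree[OF \<gamma> eq])
      show "x \<in> multi_cycle_arcs \<gamma>" "y \<in> multi_cycle_arcs \<delta>"
        using that C D pC unfolding multi_cycle_arcs_def by blast+
    qed (use that in simp)
    have "p \<noteq> []" "q \<noteq> []" using sp sq by (auto simp: simple_closed_w_def closed_w_def)
    hence "hd p = hd q" using p(2) q(2) by (intro ag) auto
    hence "p = q" using simple_closed_w_eqI[OF sp sq _ ag] by blast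
    thus "C \<in> \<delta>" using Cp Dq D(1) by simp
  qed
  thus "\<gamma> = \<delta>" if "\<gamma> \<in> multi_cycles" "\<delta> \<in> multi_cycles" "back_tails \<gamma> = back_tails \<delta>" for \<gamma> \<delta>
    using that by (metis subset_antisym)
qed

text \<open>
  Every arc \<open>e\<close> satisfies \<open>fst (head e) \<le> fst (tail e) + 1\<close>, and for back arcs there is even room for
  \<open>fst (tail e)\<close> on the left. Summation over the multi-cycle makes heads and tails cancel.
\<close>

lemma sum_fst_back_tails:
  assumes \<gamma>: "\<gamma> \<in> multi_cycles"
  shows "(\<Sum>e\<in>multi_cycle_arcs \<gamma> \<inter> back_arcs. fst (fst e)) \<le> multi_cycle_length \<gamma>"
proof -
  let ?A = "multi_cycle_arcs \<gamma>"
  note fin = card_multi_cycle_arcs(1)[OF \<gamma>]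
  have "(\<Sum>e\<in>?A. fst (snd e)) + (\<Sum>e\<in>?A \<inter> back_arcs. fst (fst e)) =
      (\<Sum>e\<in>?A. fst (snd e) + (if e \<in> back_arcs then fst (fst e) else 0))"
    using fin by (simp add: sum.distrib sum.inter_restrict)
  also have "\<dots> \<le> (\<Sum>e\<in>?A. fst (fst e) + 1)"
  proof (rule sum_mono)
    fix e assume "e \<in> ?A"
    hence "e \<in> arcs \<Gamma>" using multi_cycle_arcs_subset[OF \<gamma>] by blast
    thus "fst (snd e) + (if e \<in> back_arcs then fst (fst e) else 0) \<le> fst (fst e) + 1"
      using arc_fst_le[of e] by (auto simp: back_arcs_def)
  qed
  also have "\<dots> = (\<Sum>e\<in>?A. fst (snd e)) + multi_cycle_length \<gamma>"
    using sum_multi_cycle_arcs_head[OF \<gamma>, of fst] card_multi_cycle_arcs(2)[OF \<gamma>]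
    by (simp only: sum.distrib) simp
  finally show ?thesis by simp
qed

lemma card_back_tails:
  assumes \<gamma>: "\<gamma> \<in> multi_cycles"
  shows "(card (back_tails \<gamma>))\<^sup>2 \<le> 2 * multi_cycle_length \<gamma>"
proof -
  let ?B = "multi_cycle_arcs \<gamma> \<inter> back_arcs" and ?f = "\<lambda>e. fst (fst e)"
  have fin: "finite ?B" using card_multi_cycle_arcs(1)[OF \<gamma>] by simp
  have inj: "inj_on ?f ?B"
  proof (rule inj_onI)
    fix e e' assume e: "e \<in> ?B" "e' \<in> ?B" "?f e = ?f e'"
    hence "snd e = snd e'" by (auto simp: back_arcs_def)
    thus "e = e'" using multi_cycle_arcs_inj(2)[OF \<gamma>] e by (auto dest: inj_onD)
  qed
  have "card (back_tails \<gamma>) \<le> card ?B" unfolding back_tails_def using fin by (rule card_image_le)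
  also have "\<dots> = card (?f ` ?B)" using inj by (simp add: card_image)
  finally have c: "card (back_tails \<gamma>) \<le> card (?f ` ?B)" .
  have "(card (back_tails \<gamma>))\<^sup>2 \<le> card (?f ` ?B) * (card (?f ` ?B) + 1)"
    unfolding power2_eq_square using c by (intro mult_mono) auto
  also have "\<dots> \<le> 2 * \<Sum>(?f ` ?B)"
    using fin by (intro card_mult_Suc_card_le_sum) (auto simp: back_arcs_def wedge_def)
  also have "\<Sum>(?f ` ?B) = (\<Sum>e\<in>?B. fst (fst e))" using inj by (simp add: sum.reindex)
  also have "\<dots> \<le> multi_cycle_length \<gamma>" by (rule sum_fst_back_tails[OF \<gamma>])
  finally show ?thesis by simp
qed

lemma back_tails_subset:
  assumes \<gamma>: "\<gamma> \<in> multi_cycles"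
  shows "back_tails \<gamma> \<subseteq> {1..multi_cycle_length \<gamma>} \<times> {1..2 * multi_cycle_length \<gamma>}"
proof -
  have "fst e \<in> {1..multi_cycle_length \<gamma>} \<times> {1..2 * multi_cycle_length \<gamma>}"
    if "e \<in> set p" "p \<in> C" "C \<in> \<gamma>" for e p C
  proof -
    have "simple_closed_w p" "C = rotation_class p" using multi_cycles_remove[OF \<gamma> that(3,2)] by auto
    hence "closed_w p" "length p \<le> multi_cycle_length \<gamma>"
      using cycle_length_le[OF \<gamma> that(3)] by (auto simp: simple_closed_w_def)
    thus ?thesis using closed_w_bounds[of p e] that(1) by (auto simp: mem_Times_iff)
  qed
  thus ?thesis by (force simp: back_tails_def multi_cycle_arcs_def)
qed

lemma card_multi_cycles_length_le:
  assumes "n > 0"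
  shows "real (card {\<gamma> \<in> multi_cycles. multi_cycle_length \<gamma> = n})
           \<le> (sqrt (2 * real n) + 1) * (2 * (real n)\<^sup>2) powr sqrt (2 * real n)"
proof -
  define c where "c = nat \<lfloor>sqrt (2 * real n)\<rfloor>"
  let ?X = "{1..n} \<times> {1..2 * n}"
  let ?M = "{\<gamma> \<in> multi_cycles. multi_cycle_length \<gamma> = n}"
  have X: "finite ?X" "?X \<noteq> {}" "card ?X = 2 * n\<^sup>2" 
    using assms by (auto simp: power2_eq_square)
  have c: "real c \<le> sqrt (2 * real n)" by (simp add: c_def)
  have "back_tails ` ?M \<subseteq> {S. S \<subseteq> ?X \<and> card S \<le> c}"
  proof safe
    fix \<gamma> assume \<gamma>: "\<gamma> \<in> multi_cycles" "n = multi_cycle_length \<gamma>"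
    have "real (card (back_tails \<gamma>)) \<le> sqrt (2 * real n)"
      using card_back_tails[OF \<gamma>(1)] \<gamma>(2) by (intro real_le_rsqrt) (simp flip: of_nat_power)
    thus "card (back_tails \<gamma>) \<le> c" by (simp add: c_def le_nat_floor)
  qed (use back_tails_subset in fastforce)+
  moreover have "finite {S. S \<subseteq> ?X \<and> card S \<le> c}"
    by (rule finite_subset[of _ "Pow ?X"]) auto
  ultimately have "card (back_tails ` ?M) \<le> card {S. S \<subseteq> ?X \<and> card S \<le> c}"
    by (rule card_mono[rotated])
  also have "card (back_tails ` ?M) = card ?M"
    by (intro card_image inj_on_subset[OF back_tails_inj]) auto
  also have "card {S. S \<subseteq> ?X \<and> card S \<le> c} \<le> (c + 1) * card ?X ^ c"
    by (rule card_small_subsets_le[OF X(1,2)])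
  finally have "real (card ?M) \<le> real ((c + 1) * (2 * n\<^sup>2) ^ c)" unfolding X(3) by linarith
  also have "\<dots> = (real c + 1) * (2 * (real n)\<^sup>2) powr real c"
    using assms by (simp add: powr_realpow algebra_simps)
  also have "\<dots> \<le> (sqrt (2 * real n) + 1) * (2 * (real n)\<^sup>2) powr sqrt (2 * real n)"
  proof (intro mult_mono powr_mono)
    have "1 \<le> (real n)\<^sup>2" using assms by (intro one_le_power) simp
    thus "1 \<le> 2 * (real n)\<^sup>2" by simp
  qed (use c in auto)
  finally show ?thesis .
qed

text \<open>
  The bound for the number of multi-cycles has the form \<open>exp (O (sqrt n * ln n))\<close>, which is
  eventually below \<open>exp (\<epsilon> n)\<close>. The choice \<open>\<epsilon> = - ln r / 2\<close> spends half of the decay of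
  \<open>r\<^sup>n\<close> on this bound and keeps the other half for a geometric majorant.
\<close>

lemma fps_conv_radius_spectral_det_wedge: "fps_conv_radius spectral_det \<ge> 1"
  unfolding fps_conv_radius_def
proof (rule conv_radius_geI_ex)
  fix r :: real assume r: "0 < r" "ereal r < 1"
  hence "ln r < 0" by simp
  define \<epsilon> where "\<epsilon> = - ln r / 2"
  have \<epsilon>: "\<epsilon> > 0" using \<open>ln r < 0\<close> by (simp add: \<epsilon>_def)
  have rn: "r ^ n = exp (- \<epsilon> * real n) * exp (- \<epsilon> * real n)" for n
  proof -
    have "r ^ n = exp (real n * ln r)" using r by (simp add: exp_of_nat_mult)
    thus ?thesis by (simp add: \<epsilon>_def mult_exp_exp field_simps)
  qed
  have "(\<lambda>n. (sqrt (2 * real n) + 1) * (2 * (real n)\<^sup>2) powr sqrt (2 * real n) * exp (- \<epsilon> * real n)) \<longlonglongrightarrow> 0"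
    using \<epsilon> by real_asymp
  hence "eventually (\<lambda>n. (sqrt (2 * real n) + 1) * (2 * (real n)\<^sup>2) powr sqrt (2 * real n) * exp (- \<epsilon> * real n) < 1) sequentially"
    by (rule order_tendstoD) simp
  hence "eventually (\<lambda>n. norm (fps_nth spectral_det n * of_real r ^ n) \<le> exp (- \<epsilon>) ^ n) sequentially"
    using eventually_gt_at_top[of 0]
  proof eventually_elim
    case (elim n)
    let ?M = "{\<gamma> \<in> multi_cycles. multi_cycle_length \<gamma> = n}"
    have "norm (fps_nth spectral_det n) \<le> (\<Sum>\<gamma>\<in>?M. norm ((-1 :: complex) ^ card \<gamma>))"
      unfolding spectral_det_def by (simp add: sum_norm_le)
    also have "\<dots> = real (card ?M)" by (simp add: norm_power)
    also have "\<dots> \<le> (sqrt (2 * real n) + 1) * (2 * (real n)\<^sup>2) powr sqrt (2 * real n)"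
      using elim by (intro card_multi_cycles_length_le)
    finally have "norm (fps_nth spectral_det n) * exp (- \<epsilon> * real n) \<le> 
        (sqrt (2 * real n) + 1) * (2 * (real n)\<^sup>2) powr sqrt (2 * real n) * exp (- \<epsilon> * real n)"
      by (rule mult_right_mono) simp
    also have "\<dots> \<le> 1" using elim by simp
    finally have "norm (fps_nth spectral_det n) * exp (- \<epsilon> * real n) * exp (- \<epsilon> * real n) \<le> exp (- \<epsilon> * real n)"
      by simp
    thus ?case using r by (simp add: norm_mult norm_power rn mult.assoc exp_of_nat_mult[symmetric] mult.commute)
  qed
  hence "summable (\<lambda>n. fps_nth spectral_det n * of_real r ^ n)"
    by (rule summable_comparison_test_ev[OF _ summable_geometric]) (use \<epsilon> in simp)
  thus "\<exists>z. norm z = r \<and> summable (\<lambda>n. fps_nth spectral_det n * z ^ n)"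
    using r by (intro exI[of _ "of_real r"]) simp
qed

end

section \<open>The growth rate as the inverse of the smallest zero\<close>

theorem theorem4p3:
  fixes W :: "nat \<times> nat \<Rightarrow> wedge_label"
  defines "\<Gamma> \<equiv> wedge_graph W"
  defines "P \<equiv> wf_digraph.spectral_det \<Gamma>"
  defines "r \<equiv> wf_digraph.growth_rate \<Gamma>"
  shows "wf_digraph.bounded_cycles \<Gamma>
    \<and> fps_conv_radius P \<ge> 1 \<and> eval_fps P holomorphic_on ball 0 1
    \<and> (\<forall>z. ereal (norm z) < inverse r \<longrightarrow> eval_fps P z \<noteq> 0)
    \<and> (r > 1 \<longrightarrow> eval_fps P (of_real (real_of_ereal (inverse r))) = 0)"
proof -
  interpret labeled_wedge W .
  \<comment> \<open>\<open>Q = - P' / P\<close> has a positive radius of convergence, so \<open>r\<close> is finite\<close>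
  define Q where "Q = wf_digraph.closed_path_fps \<Gamma>"
  have ode: "fps_deriv P = - Q * P" and P0: "fps_nth P 0 = 1"
    unfolding P_def Q_def \<Gamma>_def by (simp_all add: fps_deriv_spectral_det finite_closed_paths)
  have RP: "fps_conv_radius P \<ge> 1"
    unfolding P_def \<Gamma>_def by (rule fps_conv_radius_spectral_det_wedge)
  have RQ: "fps_conv_radius Q = inverse r"
    unfolding Q_def r_def \<Gamma>_def by (rule fps_conv_radius_closed_path_fps)
  have "Q = - fps_deriv P * inverse P"
    using P0 by (subst ode) (simp add: mult.assoc inverse_mult_eq_1')
  moreover have "fps_conv_radius (inverse P) > 0"
    using P0 RP by (intro fps_conv_radius_inverse_pos) (auto intro: less_le_trans[of 0 1])
  moreover have "fps_conv_radius (- fps_deriv P) > 0"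
    using RP fps_conv_radius_deriv[of P] by (auto intro: less_le_trans[of 0 1])
  ultimately have RQ_pos: "fps_conv_radius Q > 0"
    using fps_conv_radius_mult[of "- fps_deriv P" "inverse P"] by (auto simp: min_def split: if_splits)
  have "eval_fps P holomorphic_on ball 0 1"
    using less_le_trans[OF _ RP] by (intro holomorphic_intros) auto
  moreover have "eval_fps P z \<noteq> 0" if "ereal (norm z) < inverse r" for z
    using eval_fps_log_deriv[OF ode P0 RQ_pos] that by (simp add: RQ)
  moreover have "eval_fps P (of_real (real_of_ereal (inverse r))) = 0" if r1: "r > 1"
  proof -
    obtain s where s: "r = ereal s" "s > 1"
      using r1 RQ_pos RQ by (cases r) auto
    have inv: "inverse r = ereal (inverse s)" using s by simp
    have "eval_fps P (of_real (inverse s)) = 0"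
    proof (rule eval_fps_eq_0_at_log_deriv_radius[OF ode P0])
      show "fps_nth Q n \<in> \<real>\<^sub>\<ge>\<^sub>0" for n
        by (simp add: Q_def closed_path_fps_def \<Gamma>_def)
      show "ereal (inverse s) < fps_conv_radius P"
        using s by (intro less_le_trans[OF _ RP]) (simp add: field_simps)
    qed (use s RQ inv in auto)
    thus ?thesis by (simp add: inv)
  qed
  ultimately show ?thesis
    using bounded_cycles_wedge RP unfolding \<Gamma>_def by blast
qed

end
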